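(* Let $\rho:\mathfrak b\oplus\mathfrak b\to\mathfrak{gl}(r,\mathbb C)$ be a multiplicity-free representation. Then $\rho$ is indecomposable if and only if there are $\lambda_1,\lambda_2\in\mathbb C$ and integers $s,t\ge0$ such that the distinct eigenvalues of $\rho(h_1)$ are $\lambda_1,\lambda_1-1,\dots,\lambda_1-s$, those of $\rho(h_2)$ are $\lambda_2,\lambda_2-1,\dots,\lambda_2-t$, and the following properties hold: $P_1$: for every $0\le i\le s$, if for any two $0\le j_1<j_2\le t$ both $(\lambda_1-i,\lambda_2-j_1)$ and $(\lambda_1-i,\lambda_2-j_2)$ are joint eigenvalues of $D_\rho$, then so is $(\lambda_1-i,\lambda_2-j)$ for every $j_1\le j\le j_2$; $P_2$: for every $0\le j\le t$, if for any two $0\le i_1<i_2\le s$ both $(\lambda_1-i_1,\lambda_2-j)$ and $(\lambda_1-i_2,\lambda_2-j)$ are joint eigenvalues of $D_\rho$, then so is $(\lambda_1-i,\lambda_2-j)$ for every $i_1\le i\le i_2$; $P_3$: for any two consecutive eigenvalues $\lambda$ and $\lambda-1$ of $\rho(h_1)$ there exists an eigenvalue $\mu$ of $\rho(h_2)$ such that $(\lambda,\mu)$ and $(\lambda-1,\mu)$ are both joint eigenvalues of $D_\rho$; $P_4$: for $j=1,2$, if both $(\lambda_1,\lambda_2)-\theta$ and $(\lambda_1,\lambda_2)-\theta-\varepsilon_j$ are joint eigenvalues of $D_\rho$, then $\rho(y_j)$ maps $V_\theta$ onto $V_{\theta+\varepsilon_j}$.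
   Context: $\mathfrak b\subset\mathfrak{sl}(2,\mathbb C)$ is the Lie algebra of lower triangular matrices, spanned by $h=\frac12\begin{pmatrix}1&0\\0&-1\end{pmatrix}$ and $y=\begin{pmatrix}0&0\\1&0\end{pmatrix}$, with $[h,y]=-y$. In $\mathfrak b\oplus\mathfrak b$ put $h_1=(h,0),h_2=(0,h),y_1=(y,0),y_2=(0,y)$. Throughout, representations $\rho$ are assumed to have $\rho(h_1)$ and $\rho(h_2)$ diagonalizable. $D_\rho:\mathbb C^r\to\mathbb C^r\oplus\mathbb C^r$ is $v\mapsto(\rho(h_1)v,\rho(h_2)v)$; its joint eigenvalues and joint eigenspaces are those of the commuting pair $(\rho(h_1),\rho(h_2))$. $\rho$ is multiplicity-free if every joint eigenspace is one dimensional. $\rho$ is indecomposable if $\mathbb C^r$ is not the direct sum of two nonzero $\rho$-invariant subspaces. $V_\theta$, $\theta=(\theta_1,\theta_2)$ a pair of non-negative integers, denotes the joint eigenspace for the joint eigenvalue $(\lambda_1-\theta_1,\lambda_2-\theta_2)$ ($\{0\}$ if this is not a joint eigenvalue). $\varepsilon_1=(1,0)$, $\varepsilon_2=(0,1)$. *)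

theory Defs
  imports "HOL-Analysis.Analysis"
begin

(* Scaling by complex scalars; the library's scaleR on matrices is only real. *)
definition mat_scale :: "complex \<Rightarrow> complex^'n^'m \<Rightarrow> complex^'n^'m"
  where "mat_scale c A = (\<chi> i j. c * A $ i $ j)"

definition commutator :: "complex^'n^'n \<Rightarrow> complex^'n^'n \<Rightarrow> complex^'n^'n"
  where "commutator A B = A ** B - B ** A"

definition borel_sl2 :: "(complex^2^2) set"
  where "borel_sl2 = {A. trace A = 0 \<and> A $ 1 $ 2 = 0}"

definition h_elt :: "complex^2^2"
  where "h_elt = vector [vector [1/2, 0], vector [0, - 1/2]]"

definition y_elt :: "complex^2^2"
  where "y_elt = vector [vector [0, 0], vector [1, 0]]"

lemma borel_sl2_eq: "borel_sl2 = {mat_scale a h_elt + mat_scale c y_elt | a c. True}"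
proof -
  have "A \<in> borel_sl2 \<longleftrightarrow> (\<exists>a c. A = mat_scale a h_elt + mat_scale c y_elt)" for A
  proof
    assume "A \<in> borel_sl2"
    then have "A = mat_scale (2 * A$1$1) h_elt + mat_scale (A$2$1) y_elt"
      by (auto simp: borel_sl2_def trace_def sum_2 mat_scale_def h_elt_def y_elt_def
          vec_eq_iff forall_2 add_eq_0_iff)
    then show "\<exists>a c. A = mat_scale a h_elt + mat_scale c y_elt" by blast
  qed (auto simp: borel_sl2_def trace_def sum_2 mat_scale_def h_elt_def y_elt_def)
  then show ?thesis by blast
qed

lemma commutator_h_y: "commutator h_elt y_elt = - y_elt"
  by (simp add: commutator_def h_elt_def y_elt_def vec_eq_iff forall_2 matrix_matrix_mult_def sum_2)

type_synonym bb = "(complex^2^2) \<times> (complex^2^2)"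

definition bb_carrier :: "bb set"
  where "bb_carrier = borel_sl2 \<times> borel_sl2"

definition bb_scale :: "complex \<Rightarrow> bb \<Rightarrow> bb"
  where "bb_scale c X = (mat_scale c (fst X), mat_scale c (snd X))"

definition bb_bracket :: "bb \<Rightarrow> bb \<Rightarrow> bb"
  where "bb_bracket X Y = (commutator (fst X) (fst Y), commutator (snd X) (snd Y))"

definition h1 :: bb where "h1 = (h_elt, 0)"
definition h2 :: bb where "h2 = (0, h_elt)"
definition y1 :: bb where "y1 = (y_elt, 0)"
definition y2 :: bb where "y2 = (0, y_elt)"

definition diagonalizable :: "complex^'n^'n \<Rightarrow> bool"
  where "diagonalizable A \<longleftrightarrow>
    (\<exists>P :: complex^'n^'n. invertible P \<and> (\<forall>i j. i \<noteq> j \<longrightarrow> (matrix_inv P ** A ** P) $ i $ j = 0))"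

(* The values of \<rho> outside bb_carrier are irrelevant.  Diagonalizability of the images of
   h1 and h2 is the standing assumption on all representations considered. *)
definition bb_rep :: "(bb \<Rightarrow> complex^'n^'n) \<Rightarrow> bool"
  where "bb_rep \<rho> \<longleftrightarrow>
    (\<forall>X\<in>bb_carrier. \<forall>Y\<in>bb_carrier. \<rho> (X + Y) = \<rho> X + \<rho> Y) \<and>
    (\<forall>c. \<forall>X\<in>bb_carrier. \<rho> (bb_scale c X) = mat_scale c (\<rho> X)) \<and>
    (\<forall>X\<in>bb_carrier. \<forall>Y\<in>bb_carrier. \<rho> (bb_bracket X Y) = commutator (\<rho> X) (\<rho> Y)) \<and>
    diagonalizable (\<rho> h1) \<and> diagonalizable (\<rho> h2)"

definition eigenvalues :: "complex^'n^'n \<Rightarrow> complex set"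
  where "eigenvalues A = {\<mu>. \<exists>v. v \<noteq> 0 \<and> A *v v = \<mu> *s v}"

definition D_map :: "(bb \<Rightarrow> complex^'n^'n) \<Rightarrow> complex^'n \<Rightarrow> (complex^'n) \<times> (complex^'n)"
  where "D_map \<rho> v = (\<rho> h1 *v v, \<rho> h2 *v v)"

(* This is {0} when \<mu> is not a joint eigenvalue. *)
definition joint_eigenspace :: "(bb \<Rightarrow> complex^'n^'n) \<Rightarrow> complex \<times> complex \<Rightarrow> (complex^'n) set"
  where "joint_eigenspace \<rho> \<mu> = {v. D_map \<rho> v = (fst \<mu> *s v, snd \<mu> *s v)}"

definition joint_eigenvalues :: "(bb \<Rightarrow> complex^'n^'n) \<Rightarrow> (complex \<times> complex) set"
  where "joint_eigenvalues \<rho> = {\<mu>. \<exists>v. v \<noteq> 0 \<and> v \<in> joint_eigenspace \<rho> \<mu>}"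

definition multiplicity_free :: "(bb \<Rightarrow> complex^'n^'n) \<Rightarrow> bool"
  where "multiplicity_free \<rho> \<longleftrightarrow>
    (\<forall>\<mu>\<in>joint_eigenvalues \<rho>. vec.dim (joint_eigenspace \<rho> \<mu>) = 1)"

definition rep_invariant :: "(bb \<Rightarrow> complex^'n^'n) \<Rightarrow> (complex^'n) set \<Rightarrow> bool"
  where "rep_invariant \<rho> U \<longleftrightarrow>
    vec.subspace U \<and> (\<forall>X\<in>bb_carrier. \<forall>u\<in>U. \<rho> X *v u \<in> U)"

definition indecomposable :: "(bb \<Rightarrow> complex^'n^'n) \<Rightarrow> bool"
  where "indecomposable \<rho> \<longleftrightarrow>
    \<not> (\<exists>U W. rep_invariant \<rho> U \<and> rep_invariant \<rho> W \<and> U \<noteq> {0} \<and> W \<noteq> {0} \<and>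
         U \<inter> W = {0} \<and> {u + w | u w. u \<in> U \<and> w \<in> W} = UNIV)"

definition joint_wt :: "complex \<Rightarrow> complex \<Rightarrow> nat \<times> nat \<Rightarrow> complex \<times> complex"
  where "joint_wt l\<^sub>1 l\<^sub>2 \<theta> = (l\<^sub>1 - of_nat (fst \<theta>), l\<^sub>2 - of_nat (snd \<theta>))"

definition V_space ::
    "(bb \<Rightarrow> complex^'n^'n) \<Rightarrow> complex \<Rightarrow> complex \<Rightarrow> nat \<times> nat \<Rightarrow> (complex^'n) set"
  where "V_space \<rho> l\<^sub>1 l\<^sub>2 \<theta> = joint_eigenspace \<rho> (joint_wt l\<^sub>1 l\<^sub>2 \<theta>)"

definition prop_P1 ::
    "(bb \<Rightarrow> complex^'n^'n) \<Rightarrow> complex \<Rightarrow> complex \<Rightarrow> nat \<Rightarrow> nat \<Rightarrow> bool"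
  where "prop_P1 \<rho> l\<^sub>1 l\<^sub>2 s t \<longleftrightarrow>
    (\<forall>i\<le>s. \<forall>j\<^sub>1 j\<^sub>2. j\<^sub>1 < j\<^sub>2 \<and> j\<^sub>2 \<le> t \<and>
       joint_wt l\<^sub>1 l\<^sub>2 (i, j\<^sub>1) \<in> joint_eigenvalues \<rho> \<and>
       joint_wt l\<^sub>1 l\<^sub>2 (i, j\<^sub>2) \<in> joint_eigenvalues \<rho> \<longrightarrow>
       (\<forall>j. j\<^sub>1 \<le> j \<and> j \<le> j\<^sub>2 \<longrightarrow> joint_wt l\<^sub>1 l\<^sub>2 (i, j) \<in> joint_eigenvalues \<rho>))"

definition prop_P2 ::
    "(bb \<Rightarrow> complex^'n^'n) \<Rightarrow> complex \<Rightarrow> complex \<Rightarrow> nat \<Rightarrow> nat \<Rightarrow> bool"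
  where "prop_P2 \<rho> l\<^sub>1 l\<^sub>2 s t \<longleftrightarrow>
    (\<forall>j\<le>t. \<forall>i\<^sub>1 i\<^sub>2. i\<^sub>1 < i\<^sub>2 \<and> i\<^sub>2 \<le> s \<and>
       joint_wt l\<^sub>1 l\<^sub>2 (i\<^sub>1, j) \<in> joint_eigenvalues \<rho> \<and>
       joint_wt l\<^sub>1 l\<^sub>2 (i\<^sub>2, j) \<in> joint_eigenvalues \<rho> \<longrightarrow>
       (\<forall>i. i\<^sub>1 \<le> i \<and> i \<le> i\<^sub>2 \<longrightarrow> joint_wt l\<^sub>1 l\<^sub>2 (i, j) \<in> joint_eigenvalues \<rho>))"

definition prop_P3 :: "(bb \<Rightarrow> complex^'n^'n) \<Rightarrow> bool"
  where "prop_P3 \<rho> \<longleftrightarrow>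
    (\<forall>l. l \<in> eigenvalues (\<rho> h1) \<and> l - 1 \<in> eigenvalues (\<rho> h1) \<longrightarrow>
       (\<exists>\<mu>\<in>eigenvalues (\<rho> h2).
          (l, \<mu>) \<in> joint_eigenvalues \<rho> \<and> (l - 1, \<mu>) \<in> joint_eigenvalues \<rho>))"

definition prop_P4 :: "(bb \<Rightarrow> complex^'n^'n) \<Rightarrow> complex \<Rightarrow> complex \<Rightarrow> bool"
  where "prop_P4 \<rho> l\<^sub>1 l\<^sub>2 \<longleftrightarrow>
    (\<forall>(y, \<epsilon>) \<in> {(y1, (1, 0)), (y2, (0, 1))}. \<forall>\<theta>.
       joint_wt l\<^sub>1 l\<^sub>2 \<theta> \<in> joint_eigenvalues \<rho> \<and>
       joint_wt l\<^sub>1 l\<^sub>2 (\<theta> + \<epsilon>) \<in> joint_eigenvalues \<rho> \<longrightarrow>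
       (*v) (\<rho> y) ` V_space \<rho> l\<^sub>1 l\<^sub>2 \<theta> = V_space \<rho> l\<^sub>1 l\<^sub>2 (\<theta> + \<epsilon>))"

end

theory Submission
  imports Defs
begin

text \<open>
Call the joint eigenvalues weights, and draw an arrow from the weight $\mu$ to $\mu - \varepsilon_j$
whenever \<open>\<rho> y\<^sub>j\<close> does not vanish on the joint eigenspace of $\mu$. Since every joint eigenspace is a
line, a nonzero vector of it is determined up to a scalar, and the decompositions of the representation
can be read off from this graph on a finite subset of $\mathbb C^2$.

An invariant subspace is the sum of the weight lines it contains
(\<open>weight_components_in_invariant_subspace\<close>), and in a direct sum of two invariant subspaces each
weight line lies in one of the summands. Hence decompositions of the representation are the same as
partitions of the weights into two sets without an arrow between them, and \<open>\<rho>\<close> is indecomposable iff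
the graph is connected (\<open>linked_imp_indecomposable\<close>, \<open>indecomposable_imp_linked\<close>).

What remains is combinatorial, and the essential point is that \<open>\<rho> y\<^sub>1\<close> and \<open>\<rho> y\<^sub>2\<close> commute. If an arrow in
direction 1 is followed by one in direction 2, then the two directions can be exchanged, because
$\rho(y_2)\rho(y_1)v = \rho(y_1)\rho(y_2)v \neq 0$. So whenever a walk in the graph moves in some
direction and later moves back, the two opposite steps can be brought next to each other and cancelled:
any two weights in one component are joined by a walk which never goes both forwards and backwards in
the same coordinate (\<open>walk_monotone\<close>). Two weights with a common coordinate are then joined by a straight
walk (\<open>walk_along_line\<close>). This gives convexity in both directions ($P_1$, $P_2$), and for neighbouring
weights it says that the arrow between them is present, which is $P_4$. A walk between two consecutive
eigenvalues of \<open>\<rho> h\<^sub>1\<close> has to cross from one to the other along an arrow, which is $P_3$; since a step changes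
a coordinate by at most one, the eigenvalues of \<open>\<rho> h\<^sub>1\<close> and of \<open>\<rho> h\<^sub>2\<close> form gapless
progressions with difference 1.

Conversely, $P_4$ puts an arrow between any two neighbouring weights, $P_1$ then connects all weights
with the same first coordinate, and $P_3$ connects each such column with the next.
\<close>

section \<open>Walks in a grid with commuting steps\<close>

text \<open>
In a walk made of backward \<open>c\<close>-steps and of \<open>d\<close>-steps, a final forward \<open>c\<close>-step can be moved towards the
beginning through the \<open>d\<close>-steps until it cancels against a backward \<open>c\<close>-step; without backward
\<open>c\<close>-steps the walk only goes forward in \<open>c\<close>. If squares can only be completed in the other way, the last
backward \<open>c\<close>-step is moved towards the end instead. Both
forms occur because \<open>d\<close> may stand for a relation or for its converse.
\<close>
lemma turning_back_step_cancels:
  assumes sv: "single_valued c"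
    and comm: "d O c \<subseteq> c O d \<or> c\<inverse> O d \<subseteq> d O c\<inverse>"
    and ux: "(u, x) \<in> (c\<inverse> \<union> d)\<^sup>*" and xw: "(x, w) \<in> c"
  shows "(u, w) \<in> (c\<inverse> \<union> d)\<^sup>* \<or> (u, w) \<in> (c \<union> d)\<^sup>*"
  using comm
proof
  assume comm: "d O c \<subseteq> c O d"
  show ?thesis
    using ux xw
  proof (induction arbitrary: w rule: rtrancl_induct)
    case base
    then show ?case by blast
  next
    case (step x' x)
    show ?case
    proof (cases "(x', x) \<in> c\<inverse>")
      case True
      then have "w = x'" using sv step.prems by (auto dest: single_valuedD)
      then show ?thesis using step.hyps(1) by blast
    next
      case False
      then have "(x', w) \<in> d O c" using step by blast
      then obtain z where z: "(x', z) \<in> c" "(z, w) \<in> d" using comm by blast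
      from step.IH[OF z(1)] show ?thesis using z(2) by (meson UnI2 rtrancl.rtrancl_into_rtrancl)
    qed
  qed
next
  assume comm: "c\<inverse> O d \<subseteq> d O c\<inverse>"
  have shift: "(v, w) \<in> (c\<inverse> \<union> d)\<^sup>* \<or> (v, w) \<in> (c \<union> d)\<^sup>*"
    if "(v, z) \<in> c\<inverse>" "(z, w) \<in> (c \<union> d)\<^sup>*" for v z
    using that(2,1)
  proof (induction arbitrary: v rule: converse_rtrancl_induct)
    case base
    then show ?case by blast
  next
    case (step z z')
    show ?case
    proof (cases "(z, z') \<in> c")
      case True
      then have "v = z'" using sv step.prems by (auto dest: single_valuedD)
      then show ?thesis using step.hyps(2) by blast
    next
      case False
      then have "(v, z') \<in> c\<inverse> O d" using step by blast
      then obtain y where y: "(v, y) \<in> d" "(y, z') \<in> c\<inverse>" using comm by blast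
      from step.IH[OF y(2)] show ?thesis using y(1) by (meson UnI2 converse_rtrancl_into_rtrancl)
    qed
  qed
  show ?thesis
    using ux
  proof (induction rule: converse_rtrancl_induct)
    case base
    then show ?case using xw by blast
  next
    case (step u' u)
    show ?case
    proof (cases "(u', u) \<in> d")
      case True
      then show ?thesis using step.IH by (meson UnI2 converse_rtrancl_into_rtrancl)
    next
      case False
      then have u': "(u', u) \<in> c\<inverse>" using step.hyps(1) by blast
      from step.IH show ?thesis
      proof
        assume "(u, w) \<in> (c\<inverse> \<union> d)\<^sup>*"
        then show ?thesis using u' by (meson UnI1 converse_rtrancl_into_rtrancl)
      qed (use shift[OF u'] in blast)
    qed
  qed
qed

text \<open>
One relation \<open>c\<close> out of \<open>a\<close> and its converse and one relation \<open>d\<close> out of \<open>b\<close> and its converse suffice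
for the whole walk: a further step either continues in the same sense or is absorbed by
\<open>turning_back_step_cancels\<close>.
\<close>
lemma walk_monotone:
  assumes sv: "single_valued a" "single_valued (a\<inverse>)" "single_valued b" "single_valued (b\<inverse>)"
    and comm: "a O b = b O a"
    and walk: "(u, w) \<in> (a \<union> a\<inverse> \<union> b \<union> b\<inverse>)\<^sup>*"
  shows "\<exists>c\<in>{a, a\<inverse>}. \<exists>d\<in>{b, b\<inverse>}. (u, w) \<in> (c \<union> d)\<^sup>*"
  using walk
proof (induction rule: rtrancl_induct)
  case base
  then show ?case by blast
next
  case (step x w)
  have comm': "b\<inverse> O a\<inverse> = a\<inverse> O b\<inverse>"
    using comm by (metis converse_relcomp)
  from step.IH obtain c d where c: "c \<in> {a, a\<inverse>}" and d: "d \<in> {b, b\<inverse>}"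
    and ux: "(u, x) \<in> (c \<union> d)\<^sup>*" by blast
  from step.hyps(2) c d have "(x, w) \<in> c \<or> (x, w) \<in> d \<or> (x, w) \<in> c\<inverse> \<or> (x, w) \<in> d\<inverse>"
    by auto
  then consider "(x, w) \<in> c \<union> d" | "(x, w) \<in> c\<inverse>" | "(x, w) \<in> d\<inverse>" by blast
  then show ?case
  proof cases
    case 1
    then show ?thesis using ux c d by (meson rtrancl.rtrancl_into_rtrancl)
  next
    case 2
    have "(u, w) \<in> ((c\<inverse>)\<inverse> \<union> d)\<^sup>* \<or> (u, w) \<in> (c\<inverse> \<union> d)\<^sup>*"
    proof (rule turning_back_step_cancels[OF _ _ _ 2])
      show "single_valued (c\<inverse>)" using c sv by auto
      show "d O c\<inverse> \<subseteq> c\<inverse> O d \<or> (c\<inverse>)\<inverse> O d \<subseteq> d O (c\<inverse>)\<inverse>"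
        using c d comm comm' by (elim insertE emptyE) simp_all
    qed (use ux in simp)
    moreover have "(c\<inverse>)\<inverse> \<in> {a, a\<inverse>}" "c\<inverse> \<in> {a, a\<inverse>}" using c by auto
    ultimately show ?thesis using d by blast
  next
    case 3
    have "(u, w) \<in> ((d\<inverse>)\<inverse> \<union> c)\<^sup>* \<or> (u, w) \<in> (d\<inverse> \<union> c)\<^sup>*"
    proof (rule turning_back_step_cancels[OF _ _ _ 3])
      show "single_valued (d\<inverse>)" using d sv by auto
      show "c O d\<inverse> \<subseteq> d\<inverse> O c \<or> (d\<inverse>)\<inverse> O c \<subseteq> c O (d\<inverse>)\<inverse>"
        using c d comm comm' by (elim insertE emptyE) simp_all
    qed (use ux in \<open>simp add: Un_commute\<close>)
    moreover have "(d\<inverse>)\<inverse> \<in> {b, b\<inverse>}" "d\<inverse> \<in> {b, b\<inverse>}" using d by auto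
    ultimately show ?thesis using c by (metis Un_commute)
  qed
qed

text \<open>
In a monotone walk nothing cancels, so the displacement counts the steps in each direction; in
particular a walk with equal \<open>f\<close>-coordinates at its ends has no \<open>c\<close>-step at all.
\<close>
lemma monotone_walk_displacement:
  fixes f g :: "'k \<Rightarrow> complex"
  assumes c: "\<And>x y. (x, y) \<in> c \<Longrightarrow> f y = f x + \<sigma> \<and> g y = g x"
    and d: "\<And>x y. (x, y) \<in> d \<Longrightarrow> f y = f x \<and> g y = g x + \<tau>"
    and "(u, w) \<in> (c \<union> d)\<^sup>*"
  shows "\<exists>p q :: nat. f w = f u + of_nat p * \<sigma> \<and> g w = g u + of_nat q * \<tau> \<and>
           (p = 0 \<longrightarrow> (u, w) \<in> d ^^ q)"
  using assms(3)
proof (induction rule: rtrancl_induct)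
  case base
  show ?case by (rule exI[of _ 0], rule exI[of _ 0]) simp
next
  case (step x w)
  then obtain p q :: nat where pq: "f x = f u + of_nat p * \<sigma>" "g x = g u + of_nat q * \<tau>"
    "p = 0 \<longrightarrow> (u, x) \<in> d ^^ q" by blast
  show ?case
  proof (cases "(x, w) \<in> c")
    case True
    then show ?thesis
      using pq c[OF True] by (intro exI[of _ "Suc p"] exI[of _ q]) (simp add: algebra_simps)
  next
    case False
    then have xw: "(x, w) \<in> d" using step.hyps by blast
    then show ?thesis
      using pq d[OF xw] by (intro exI[of _ p] exI[of _ "Suc q"]) (auto simp: algebra_simps)
  qed
qed

text \<open>
A monotone walk between points with the same \<open>f\<close>-coordinate can use neither \<open>a\<close> nor its converse, and then
the \<open>g\<close>-coordinate says which of \<open>b\<close> and its converse it uses, and how often.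
\<close>
lemma walk_along_line:
  fixes f g :: "'k \<Rightarrow> complex"
  assumes inj: "\<And>x y. f x = f y \<Longrightarrow> g x = g y \<Longrightarrow> x = y"
    and a: "\<And>x y. (x, y) \<in> a \<Longrightarrow> f y = f x - 1 \<and> g y = g x"
    and b: "\<And>x y. (x, y) \<in> b \<Longrightarrow> f y = f x \<and> g y = g x - 1"
    and comm: "a O b = b O a"
    and walk: "(u, w) \<in> (a \<union> a\<inverse> \<union> b \<union> b\<inverse>)\<^sup>*"
    and f: "f w = f u" and g: "g w = g u - of_nat m"
  shows "(u, w) \<in> b ^^ m"
proof -
  have "single_valued a" "single_valued (a\<inverse>)" "single_valued b" "single_valued (b\<inverse>)"
    by (auto intro!: single_valuedI inj dest!: a b)
  from walk_monotone[OF this comm walk] obtain c d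
    where c: "c \<in> {a, a\<inverse>}" and d: "d \<in> {b, b\<inverse>}" and cd: "(u, w) \<in> (c \<union> d)\<^sup>*" by blast
  define \<sigma> \<tau> :: complex where "\<sigma> = (if c = a then -1 else 1)" and "\<tau> = (if d = b then -1 else 1)"
  have cs: "f y = f x + \<sigma> \<and> g y = g x" if "(x, y) \<in> c" for x y
    using that c a[of x y] a[of y x] by (auto simp: \<sigma>_def split: if_splits)
  have ds: "f y = f x \<and> g y = g x + \<tau>" if "(x, y) \<in> d" for x y
    using that d b[of x y] b[of y x] by (auto simp: \<tau>_def split: if_splits)
  from monotone_walk_displacement[of c f \<sigma> g d \<tau> u w, OF cs ds cd]
  obtain p q :: nat where p: "f w = f u + of_nat p * \<sigma>" and q: "g w = g u + of_nat q * \<tau>"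
    and walk': "p = 0 \<longrightarrow> (u, w) \<in> d ^^ q" by blast
  have "p = 0" using p f by (auto simp: \<sigma>_def split: if_splits)
  with walk' have uw: "(u, w) \<in> d ^^ q" by simp
  show ?thesis
  proof (cases "d = b")
    case True
    then have "(of_nat q :: complex) = of_nat m" using q g by (simp add: \<tau>_def)
    then show ?thesis using uw True by simp
  next
    case False
    \<comment> \<open>Here the walk follows the converse of \<open>b\<close>, which raises \<open>g\<close>; it cannot reach a lower value, so it is trivial.\<close>
    then have "g u + of_nat q = g u - of_nat m" using q g by (simp add: \<tau>_def)
    then have "of_nat q + of_nat m = (0 :: complex)" by (simp add: algebra_simps)
    then have "q = 0" "m = 0" by (metis of_nat_add of_nat_eq_0_iff add_is_0)+
    then show ?thesis using uw by simp
  qed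
qed

text \<open>
A discrete intermediate value argument: a walk from \<open>x0\<close> to \<open>x0 + k\<close> by steps of size at most one
passes through every point in between. So the occurring integers \<open>k\<close> form an interval, which is finite.
\<close>
lemma finite_unit_step_connected_arithmetic:
  fixes F :: "complex set"
  assumes fin: "finite F" and x0: "x0 \<in> F"
    and conn: "\<And>x. x \<in> F \<Longrightarrow> (x0, x) \<in> {(x, y). x \<in> F \<and> y \<in> F \<and> y \<in> {x - 1, x, x + 1}}\<^sup>*"
  shows "\<exists>l. \<exists>s::nat. F = {l - of_nat i | i. i \<le> s}"
proof -
  \<comment> \<open>The integers \<open>k\<close> measure the position relative to \<open>x0\<close>; all of \<open>F\<close> will turn out to be at integer distance.\<close>
  define K where "K = {k :: int. x0 + of_int k \<in> F}"
  have path: "\<exists>k::int. x = x0 + of_int k \<and> (\<forall>j. (0 \<le> j \<and> j \<le> k) \<or> (k \<le> j \<and> j \<le> 0) \<longrightarrow> j \<in> K)"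
    if "x \<in> F" for x
    using conn[OF that]
  proof (induction rule: rtrancl_induct)
    case base
    show ?case using x0 by (intro exI[of _ 0]) (auto simp: K_def)
  next
    case (step x y)
    then obtain k :: int where k: "x = x0 + of_int k"
      "\<And>j. (0 \<le> j \<and> j \<le> k) \<or> (k \<le> j \<and> j \<le> 0) \<Longrightarrow> j \<in> K" by blast
    from step.hyps(2) have y: "y \<in> F" "y = x - 1 \<or> y = x \<or> y = x + 1" by auto
    then obtain k' where k': "y = x0 + of_int k'" "k' \<in> {k - 1, k, k + 1}"
      using k(1) by (auto intro: that[of "k - 1"] that[of "k + 1"])
    have "k' \<in> K" using k' y by (simp add: K_def)
    have "j \<in> K" if "(0 \<le> j \<and> j \<le> k') \<or> (k' \<le> j \<and> j \<le> 0)" for j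
    proof (cases "j = k'")
      case False
      then show ?thesis using that k'(2) by (intro k(2)) auto
    qed (use \<open>k' \<in> K\<close> in simp)
    then show ?case using k' by blast
  qed
  have "finite ((\<lambda>k. x0 + of_int k :: complex) -` F)"
    by (rule finite_vimageI[OF fin]) (auto simp: inj_def)
  then have finK: "finite K" by (simp add: K_def vimage_def)
  have "0 \<in> K" using x0 by (simp add: K_def)
  then have ne: "K \<noteq> {}" by auto
  define M m where "M = Max K" and "m = Min K"
  have mM: "m \<in> K" "M \<in> K" "m \<le> 0" "0 \<le> M" and bounds: "\<And>k. k \<in> K \<Longrightarrow> m \<le> k \<and> k \<le> M"
    using finK ne \<open>0 \<in> K\<close> by (auto simp: M_def m_def)
  have conv: "j \<in> K" if "k \<in> K" "(0 \<le> j \<and> j \<le> k) \<or> (k \<le> j \<and> j \<le> 0)" for j k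
    proof -
    have "x0 + of_int k \<in> F" using that(1) by (simp add: K_def)
    from path[OF this] obtain k' :: int where "x0 + of_int k = x0 + of_int k'"
      "\<forall>j. (0 \<le> j \<and> j \<le> k') \<or> (k' \<le> j \<and> j \<le> 0) \<longrightarrow> j \<in> K" by blast
    then show ?thesis using that(2) by auto
  qed
  have K: "K = {m..M}"
  proof (intro equalityI subsetI)
    fix j assume "j \<in> {m..M}"
    then show "j \<in> K" using conv[OF mM(1), of j] conv[OF mM(2), of j] by (cases "0 \<le> j") auto
  qed (use bounds in auto)
  have "F = {x0 + of_int M - of_nat i | i. i \<le> nat (M - m)}"
  proof (intro equalityI subsetI)
    fix x assume "x \<in> F"
    then obtain k where k: "x = x0 + of_int k" using path by blast
    then have "k \<in> {m..M}" using \<open>x \<in> F\<close> K by (auto simp: K_def)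
    then show "x \<in> {x0 + of_int M - of_nat i | i. i \<le> nat (M - m)}"
      unfolding k by (intro CollectI exI[of _ "nat (M - k)"]) (auto simp: nat_mono of_nat_nat)
  next
    fix x assume "x \<in> {x0 + of_int M - of_nat i | i. i \<le> nat (M - m)}"
    then obtain i where i: "x = x0 + of_int M - of_nat i" "i \<le> nat (M - m)" by blast
    then have "M - int i \<in> K" using mM K by auto
    then have "x0 + of_int (M - int i) \<in> F" by (simp add: K_def)
    then show "x \<in> F" using i(1) by (simp add: add_diff_eq)
  qed
  then show ?thesis by blast
qed

section \<open>Simultaneous eigenvectors in invariant subspaces\<close>

text \<open>
Eigenvectors of a family of operators are separated by applying the operators: for an index \<open>l\<close> and an
operator \<open>M i\<close> that distinguishes \<open>k\<close> from \<open>l\<close>, the operator \<open>M i - \<omega> l i\<close> kills \<open>f l\<close>, multiplies \<open>f k\<close>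
by a nonzero scalar and preserves \<open>U\<close>. For \<open>U = {0}\<close> this is the linear independence of eigenspaces.
\<close>
lemma component_in_invariant_subspace:
  fixes M :: "'i \<Rightarrow> complex^'n^'n" and \<omega> :: "'k \<Rightarrow> 'i \<Rightarrow> complex"
  assumes "finite S" and U: "vec.subspace U"
    and inv: "\<And>i u. i \<in> I \<Longrightarrow> u \<in> U \<Longrightarrow> M i *v u \<in> U"
    and eig: "\<And>k i. k \<in> S \<Longrightarrow> i \<in> I \<Longrightarrow> M i *v f k = \<omega> k i *s f k"
    and sep: "\<And>k l. k \<in> S \<Longrightarrow> l \<in> S \<Longrightarrow> k \<noteq> l \<Longrightarrow> \<exists>i\<in>I. \<omega> k i \<noteq> \<omega> l i"
    and sum: "(\<Sum>k\<in>S. f k) \<in> U" and "k \<in> S"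
  shows "f k \<in> U"
  using \<open>finite S\<close> eig sep sum \<open>k \<in> S\<close>
proof (induction S arbitrary: f k rule: finite_induct)
  case empty
  then show ?case by simp
next
  case (insert l S)
  have others: "f k \<in> U" if k: "k \<in> S" for k
  proof -
    obtain i where i: "i \<in> I" "\<omega> k i \<noteq> \<omega> l i"
      using insert.prems(2)[of k l] insert.hyps k by auto
    define f' where "f' m = (\<omega> m i - \<omega> l i) *s f m" for m
    have "M i *v (\<Sum>m\<in>insert l S. f m) = (\<Sum>m\<in>insert l S. \<omega> m i *s f m)"
      using insert.prems(1) i(1) by (simp add: vec.linear_sum[OF matrix_vector_mul_linear_gen])
    then have "(\<Sum>m\<in>insert l S. f' m) = M i *v (\<Sum>m\<in>insert l S. f m) - \<omega> l i *s (\<Sum>m\<in>insert l S. f m)"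
      unfolding f'_def vec.scale_left_diff_distrib sum_subtractf vec.scale_sum_right by simp
    moreover have "f' l = 0" by (simp add: f'_def)
    ultimately have "(\<Sum>m\<in>S. f' m) = M i *v (\<Sum>m\<in>insert l S. f m) - \<omega> l i *s (\<Sum>m\<in>insert l S. f m)"
      using insert.hyps by simp
    also have "\<dots> \<in> U"
      using insert.prems(3) i(1) by (intro vec.subspace_diff vec.subspace_scale inv U)
    finally have sum': "(\<Sum>m\<in>S. f' m) \<in> U" .
    have eig': "M j *v f' m = \<omega> m j *s f' m" if "m \<in> S" "j \<in> I" for m j
    proof -
      have "M j *v f m = \<omega> m j *s f m" using insert.prems(1)[of m j] that by simp
      then have "M j *v (c *s f m) = \<omega> m j *s (c *s f m)" for c
        by (simp add: vector_scalar_commute mult.commute)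
      then show ?thesis unfolding f'_def .
    qed
    have "f' k \<in> U"
      by (rule insert.IH[OF eig' _ sum' k]) (use insert.prems(2) in auto)
    then have "inverse (\<omega> k i - \<omega> l i) *s f' k \<in> U" by (rule vec.subspace_scale[OF U])
    moreover have "inverse (\<omega> k i - \<omega> l i) *s f' k = f k"
      unfolding f'_def vec.scale_scale using i(2) by simp
    ultimately show ?thesis by simp
  qed
  have "f l = (\<Sum>m\<in>insert l S. f m) - (\<Sum>m\<in>S. f m)"
    using insert.hyps by simp
  also have "\<dots> \<in> U"
    by (rule vec.subspace_diff[OF U insert.prems(3) vec.subspace_sum[OF U others]])
  finally show ?case using others insert.prems(4) by blast
qed

text \<open>
The columns of the diagonalizing matrix are eigenvectors; those with the same eigenvalue are collected
into one summand. The set \<open>S\<close> of eigenvalues does not depend on the vector, which later bounds the set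
of weights.
\<close>
lemma diagonalizable_eigenvector_sum:
  fixes A :: "complex^'n^'n"
  assumes "diagonalizable A"
  shows "\<exists>S. finite S \<and> (\<forall>v. \<exists>f. v = (\<Sum>a\<in>S. f a) \<and> (\<forall>a\<in>S. A *v f a = a *s f a))"
proof -
  obtain P :: "complex^'n^'n" where P: "invertible P"
    and diag: "\<And>i j. i \<noteq> j \<Longrightarrow> (matrix_inv P ** A ** P) $ i $ j = 0"
    using assms by (auto simp: diagonalizable_def)
  define D where "D = matrix_inv P ** A ** P"
  define d where "d i = D $ i $ i" for i
  have PP: "P ** matrix_inv P = mat 1" using P unfolding invertible_def matrix_inv_def
    by (rule someI2_ex) blast
  then have "P ** D = A ** P" by (simp add: D_def matrix_mul_assoc)
  have col: "A *v column i P = d i *s column i P" for i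
  proof -
    have "A *v column i P = column i (A ** P)"
      by (simp add: vec_eq_iff column_def matrix_vector_mult_def matrix_matrix_mult_def)
    also have "\<dots> = column i (P ** D)" by (simp add: \<open>P ** D = A ** P\<close>)
    also have "\<dots> = d i *s column i P"
    proof -
      have "(\<Sum>k\<in>UNIV. P $ j $ k * D $ k $ i) = P $ j $ i * D $ i $ i" for j
        using diag by (subst sum.remove[of _ i]) (auto simp: D_def intro!: sum.neutral)
      then show ?thesis
        by (simp add: vec_eq_iff column_def matrix_matrix_mult_def d_def)
    qed
    finally show ?thesis .
  qed
  have "\<exists>f. v = (\<Sum>a\<in>range d. f a) \<and> (\<forall>a\<in>range d. A *v f a = a *s f a)" for v
  proof -
    define p where "p i = (matrix_inv P *v v) $ i *s column i P" for i
    define f where "f a = (\<Sum>i\<in>{i \<in> UNIV. d i = a}. p i)" for a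
    have "v = P *v (matrix_inv P *v v)" by (simp add: matrix_vector_mul_assoc PP)
    also have "\<dots> = (\<Sum>i\<in>UNIV. p i)" by (simp add: matrix_mult_sum p_def)
    also have "\<dots> = (\<Sum>a\<in>range d. f a)" unfolding f_def by (rule sum.image_gen) simp
    finally have "v = (\<Sum>a\<in>range d. f a)" .
    moreover have "A *v f a = a *s f a" for a
      unfolding f_def vec.linear_sum[OF matrix_vector_mul_linear_gen] vec.scale_sum_right
      by (rule sum.cong) (auto simp: p_def vector_scalar_commute col mult.commute)
    ultimately show ?thesis by blast
  qed
  then show ?thesis by (intro exI[of _ "range d"]) simp
qed

lemma subspace_eigenspace: "vec.subspace {v. (A :: complex^'n^'n) *v v = l *s v}"
  by (auto simp: vec.subspace_def matrix_vector_right_distrib vec.scale_right_distrib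
      vector_scalar_commute mult.commute)

text \<open>
The components of an eigenvector for \<open>l\<close> lie in the eigenspace of \<open>l\<close>, so those for other eigenvalues vanish.
\<close>
lemma eigenvalue_in_decomposition:
  fixes A :: "complex^'n^'n"
  assumes "finite S" and dec: "\<And>v. \<exists>f. v = (\<Sum>a\<in>S. f a) \<and> (\<forall>a\<in>S. A *v f a = a *s f a)"
    and v: "A *v v = l *s v" "v \<noteq> 0"
  shows "l \<in> S"
proof (rule ccontr)
  assume l: "l \<notin> S"
  from dec obtain f where f: "v = (\<Sum>a\<in>S. f a)" "\<And>a. a \<in> S \<Longrightarrow> A *v f a = a *s f a" by blast
  have "f a = 0" if a: "a \<in> S" for a
  proof -
    have "f a \<in> {x. A *v x = l *s x}"
      by (rule component_in_invariant_subspace[where M = "\<lambda>_::unit. A" and \<omega> = "\<lambda>a _. a" and I = UNIV, OF \<open>finite S\<close> subspace_eigenspace])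
        (use f v a in \<open>auto simp: vector_scalar_commute\<close>)
    then have "(a - l) *s f a = 0" using f(2)[OF a] by (simp add: vec.scale_left_diff_distrib)
    then show ?thesis using a l by auto
  qed
  then show False using f(1) v(2) by simp
qed

section \<open>Generators of the Lie algebra and their relations\<close>

lemma commutator_zero [simp]: "commutator A 0 = 0" "commutator 0 A = 0"
  by (simp_all add: commutator_def)

lemma mat_scale_mult_vec: "mat_scale c A *v v = c *s (A *v v)"
  by (simp add: mat_scale_def matrix_vector_mult_def vec_eq_iff sum_distrib_left mult.assoc)

lemma mat_scale_zero [simp]: "mat_scale c 0 = 0"
  by (simp add: mat_scale_def vec_eq_iff)

lemma bb_generators: "h1 \<in> bb_carrier" "h2 \<in> bb_carrier" "y1 \<in> bb_carrier" "y2 \<in> bb_carrier"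
  unfolding bb_carrier_def h1_def h2_def y1_def y2_def borel_sl2_def h_elt_def y_elt_def
  by (simp_all add: trace_def sum_2)

lemma bb_brackets:
  "bb_bracket h1 h2 = 0" "bb_bracket y1 y2 = 0" "bb_bracket h1 y2 = 0" "bb_bracket h2 y1 = 0"
  "bb_bracket h1 y1 = bb_scale (-1) y1" "bb_bracket h2 y2 = bb_scale (-1) y2"
proof -
  have "mat_scale (-1) A = - A" for A :: "complex^2^2" by (simp add: mat_scale_def vec_eq_iff)
  then show
    "bb_bracket h1 h2 = 0" "bb_bracket y1 y2 = 0" "bb_bracket h1 y2 = 0" "bb_bracket h2 y1 = 0"
    "bb_bracket h1 y1 = bb_scale (-1) y1" "bb_bracket h2 y2 = bb_scale (-1) y2"
    by (simp_all add: bb_bracket_def bb_scale_def h1_def h2_def y1_def y2_def commutator_h_y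
        zero_prod_def)
qed

lemma bb_carrier_decomposition:
  assumes "X \<in> bb_carrier"
  shows "\<exists>a c a' c'. X = bb_scale a h1 + bb_scale c y1 + bb_scale a' h2 + bb_scale c' y2"
proof -
  obtain a c a' c' where "fst X = mat_scale a h_elt + mat_scale c y_elt"
    "snd X = mat_scale a' h_elt + mat_scale c' y_elt"
    using assms by (auto simp: bb_carrier_def borel_sl2_eq)
  then show ?thesis
    by (rule_tac x = a in exI, rule_tac x = c in exI, rule_tac x = a' in exI, rule_tac x = c' in exI)
      (simp add: prod_eq_iff bb_scale_def h1_def h2_def y1_def y2_def)
qed

lemma bb_scale_carrier: "X \<in> bb_carrier \<Longrightarrow> bb_scale c X \<in> bb_carrier"
  by (auto simp: bb_carrier_def bb_scale_def borel_sl2_def mat_scale_def trace_def sum_2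
      simp flip: distrib_left)

lemma bb_add_carrier: "X \<in> bb_carrier \<Longrightarrow> Y \<in> bb_carrier \<Longrightarrow> X + Y \<in> bb_carrier"
  by (auto simp: bb_carrier_def borel_sl2_def trace_def sum.distrib)

text \<open>
Generators paired with the weight they subtract, so that statements about the two coordinates can be
proved once.
\<close>
definition lowering :: "(bb \<times> complex \<times> complex) set" where
  "lowering = {(y1, (1, 0)), (y2, (0, 1))}"

definition arrows :: "(bb \<Rightarrow> complex^'n^'n) \<Rightarrow> bb \<Rightarrow> complex \<times> complex \<Rightarrow>
    ((complex \<times> complex) \<times> (complex \<times> complex)) set" where
  "arrows \<rho> y \<epsilon> = {(\<mu>, \<mu> - \<epsilon>) | \<mu>. \<exists>v\<in>joint_eigenspace \<rho> \<mu>. \<rho> y *v v \<noteq> 0}"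

definition weight_links :: "(bb \<Rightarrow> complex^'n^'n) \<Rightarrow>
    ((complex \<times> complex) \<times> (complex \<times> complex)) set" where
  "weight_links \<rho> = arrows \<rho> y1 (1, 0) \<union> (arrows \<rho> y1 (1, 0))\<inverse> \<union>
     arrows \<rho> y2 (0, 1) \<union> (arrows \<rho> y2 (0, 1))\<inverse>"

locale multiplicity_free_rep =
  fixes \<rho> :: "bb \<Rightarrow> complex^'n^'n"
  assumes rep: "bb_rep \<rho>" and mult_free: "multiplicity_free \<rho>"
begin

abbreviation "V \<equiv> joint_eigenspace \<rho>"
abbreviation "\<Lambda> \<equiv> joint_eigenvalues \<rho>"

lemma rep_add: "X \<in> bb_carrier \<Longrightarrow> Y \<in> bb_carrier \<Longrightarrow> \<rho> (X + Y) = \<rho> X + \<rho> Y"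
  and rep_scale: "X \<in> bb_carrier \<Longrightarrow> \<rho> (bb_scale c X) = mat_scale c (\<rho> X)"
  and rep_bracket: "X \<in> bb_carrier \<Longrightarrow> Y \<in> bb_carrier \<Longrightarrow> \<rho> (bb_bracket X Y) = commutator (\<rho> X) (\<rho> Y)"
  using rep by (auto simp: bb_rep_def)

lemma rep_zero: "\<rho> 0 = 0"
proof -
  have "bb_scale 0 h1 = 0" by (simp add: bb_scale_def mat_scale_def prod_eq_iff vec_eq_iff)
  then show ?thesis
    using rep_scale[OF bb_generators(1), of 0] by (simp add: mat_scale_def vec_eq_iff)
qed

lemma rep_swap:
  assumes "X \<in> bb_carrier" "Y \<in> bb_carrier"
  shows "\<rho> X *v (\<rho> Y *v v) = \<rho> Y *v (\<rho> X *v v) + \<rho> (bb_bracket X Y) *v v"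
  by (simp add: rep_bracket[OF assms] commutator_def matrix_vector_mul_assoc
      matrix_vector_mult_diff_rdistrib)

lemma rep_invariantI:
  assumes U: "vec.subspace U"
    and gen: "\<And>X u. X \<in> {h1, h2, y1, y2} \<Longrightarrow> u \<in> U \<Longrightarrow> \<rho> X *v u \<in> U"
  shows "rep_invariant \<rho> U"
  unfolding rep_invariant_def
proof (intro conjI U ballI)
  fix X u assume X: "X \<in> bb_carrier" and u: "u \<in> U"
  obtain a c a' c' where X: "X = bb_scale a h1 + bb_scale c y1 + bb_scale a' h2 + bb_scale c' y2"
    using bb_carrier_decomposition[OF X] by blast
  have "\<rho> X *v u = a *s (\<rho> h1 *v u) + c *s (\<rho> y1 *v u) + a' *s (\<rho> h2 *v u) + c' *s (\<rho> y2 *v u)"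
    unfolding X
    by (simp add: rep_add rep_scale bb_scale_carrier bb_add_carrier bb_generators
        matrix_vector_mult_add_rdistrib mat_scale_mult_vec)
  also have "\<dots> \<in> U" using u by (intro vec.subspace_add vec.subspace_scale U gen) auto
  finally show "\<rho> X *v u \<in> U" .
qed

section \<open>Weights and weight spaces\<close>

lemma V_iff: "v \<in> V \<mu> \<longleftrightarrow> \<rho> h1 *v v = fst \<mu> *s v \<and> \<rho> h2 *v v = snd \<mu> *s v"
  by (simp add: joint_eigenspace_def D_map_def)

lemma subspace_V: "vec.subspace (V \<mu>)"
proof -
  have "V \<mu> = {v. \<rho> h1 *v v = fst \<mu> *s v} \<inter> {v. \<rho> h2 *v v = snd \<mu> *s v}"
    by (auto simp: V_iff)
  then show ?thesis by (simp add: vec.subspace_inter subspace_eigenspace)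
qed

lemma weightI: "v \<in> V \<mu> \<Longrightarrow> v \<noteq> 0 \<Longrightarrow> \<mu> \<in> \<Lambda>"
  by (auto simp: joint_eigenvalues_def)

lemma weightE:
  assumes "\<mu> \<in> \<Lambda>"
  obtains v where "v \<in> V \<mu>" "v \<noteq> 0"
  using assms by (auto simp: joint_eigenvalues_def)

lemma V_multiple:
  assumes v: "v \<in> V \<mu>" "v \<noteq> 0" and w: "w \<in> V \<mu>"
  shows "\<exists>c. w = c *s v"
proof -
  have "vec.dim (V \<mu>) = 1"
    using mult_free weightI[OF v] by (simp add: multiplicity_free_def)
  then have "V \<mu> \<subseteq> vec.span {v}"
    using v by (intro vec.card_ge_dim_independent) auto
  then show ?thesis using w by (auto simp: vec.span_singleton)
qed

lemma weight_components_in_invariant_subspace: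
  assumes "finite S" "vec.subspace U"
    and "\<And>u. u \<in> U \<Longrightarrow> \<rho> h1 *v u \<in> U" "\<And>u. u \<in> U \<Longrightarrow> \<rho> h2 *v u \<in> U"
    and f: "\<And>\<mu>. \<mu> \<in> S \<Longrightarrow> f \<mu> \<in> V \<mu>" and "(\<Sum>\<mu>\<in>S. f \<mu>) \<in> U" "\<mu> \<in> S"
  shows "f \<mu> \<in> U"
proof (rule component_in_invariant_subspace[where M = "\<lambda>first. if first then \<rho> h1 else \<rho> h2"
      and \<omega> = "\<lambda>\<mu> first. if first then fst \<mu> else snd \<mu>" and I = UNIV and S = S])
  show "\<exists>i\<in>UNIV. (if i then fst k else snd k) \<noteq> (if i then fst l else snd l)"
    if "k \<noteq> l" for k l :: "complex \<times> complex"
    using that by (auto simp: prod_eq_iff intro: bexI[of _ True] bexI[of _ False])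
qed (use assms in \<open>auto simp: V_iff\<close>)

text \<open>
A vector is split into eigenvectors of \<open>\<rho> h1\<close>, and each of these into eigenvectors of \<open>\<rho> h2\<close>. The second
splitting stays inside the eigenspaces of \<open>\<rho> h1\<close>, since these are invariant under the commuting
operator \<open>\<rho> h2\<close>. Summands at pairs of eigenvalues that are not weights vanish.
\<close>
lemma weight_decomposition:
  shows finite_weights: "finite \<Lambda>"
    and weight_sum: "\<exists>f. v = (\<Sum>\<mu>\<in>\<Lambda>. f \<mu>) \<and> (\<forall>\<mu>. f \<mu> \<in> V \<mu>)"
proof -
  have "diagonalizable (\<rho> h1)" "diagonalizable (\<rho> h2)" using rep by (auto simp: bb_rep_def)
  then obtain S T where S: "finite S" "\<And>v. \<exists>f. v = (\<Sum>a\<in>S. f a) \<and> (\<forall>a\<in>S. \<rho> h1 *v f a = a *s f a)"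
    and T: "finite T" "\<And>v. \<exists>f. v = (\<Sum>a\<in>T. f a) \<and> (\<forall>a\<in>T. \<rho> h2 *v f a = a *s f a)"
    using diagonalizable_eigenvector_sum[of "\<rho> h1"] diagonalizable_eigenvector_sum[of "\<rho> h2"] by blast
  have ST: "\<Lambda> \<subseteq> S \<times> T"
  proof
    fix \<mu> assume "\<mu> \<in> \<Lambda>"
    then obtain v where v: "v \<in> V \<mu>" "v \<noteq> 0" by (rule weightE)
    then have "fst \<mu> \<in> S" "snd \<mu> \<in> T"
      using eigenvalue_in_decomposition[OF S, of v "fst \<mu>"]
        eigenvalue_in_decomposition[OF T, of v "snd \<mu>"] by (simp_all add: V_iff)
    then show "\<mu> \<in> S \<times> T" by (simp add: mem_Times_iff)
  qed
  show "finite \<Lambda>" using ST S(1) T(1) by (meson finite_SigmaI finite_subset)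
  obtain f where f: "v = (\<Sum>a\<in>S. f a)" "\<And>a. a \<in> S \<Longrightarrow> \<rho> h1 *v f a = a *s f a" using S(2) by blast
  have "\<forall>a. \<exists>h. f a = (\<Sum>b\<in>T. h b) \<and> (\<forall>b\<in>T. \<rho> h2 *v h b = b *s h b)"
    using T(2) by blast
  from choice[OF this] obtain g where g: "\<And>a. f a = (\<Sum>b\<in>T. g a b)"
    "\<And>a b. b \<in> T \<Longrightarrow> \<rho> h2 *v g a b = b *s g a b" by blast
  have gV: "g a b \<in> V (a, b)" if "a \<in> S" "b \<in> T" for a b
  proof -
    have "g a b \<in> {v. \<rho> h1 *v v = a *s v}"
    proof (rule component_in_invariant_subspace[where M = "\<lambda>_::unit. \<rho> h2" and \<omega> = "\<lambda>b _. b" and I = UNIV,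
          OF \<open>finite T\<close> subspace_eigenspace])
      show "\<rho> h2 *v u \<in> {v. \<rho> h1 *v v = a *s v}" if "u \<in> {v. \<rho> h1 *v v = a *s v}" for u
        using that by (simp add: rep_swap[of h1 h2] bb_generators bb_brackets rep_zero vector_scalar_commute)
      show "(\<Sum>b\<in>T. g a b) \<in> {v. \<rho> h1 *v v = a *s v}"
        using f(2)[OF \<open>a \<in> S\<close>] by (simp flip: g(1))
    qed (use that g(2) in auto)
    then show ?thesis using g(2)[OF that(2)] by (simp add: V_iff)
  qed
  define G where "G \<mu> = (if \<mu> \<in> S \<times> T then g (fst \<mu>) (snd \<mu>) else 0)" for \<mu>
  have GV: "G \<mu> \<in> V \<mu>" for \<mu>
    using gV[of "fst \<mu>" "snd \<mu>"] vec.subspace_0[OF subspace_V] by (auto simp: G_def)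
  have "v = (\<Sum>a\<in>S. \<Sum>b\<in>T. g a b)" unfolding g(1)[symmetric] by (rule f(1))
  also have "\<dots> = (\<Sum>\<mu>\<in>S \<times> T. G \<mu>)"
    unfolding sum.cartesian_product by (rule sum.cong) (auto simp: G_def)
  also have "\<dots> = (\<Sum>\<mu>\<in>\<Lambda>. G \<mu>)"
    using S(1) T(1) ST weightI[OF GV] by (intro sum.mono_neutral_right) blast+
  finally show "\<exists>f. v = (\<Sum>\<mu>\<in>\<Lambda>. f \<mu>) \<and> (\<forall>\<mu>. f \<mu> \<in> V \<mu>)" using GV by blast
qed

lemma weight_vector_in_invariant_subspace:
  assumes U: "vec.subspace U" "\<And>u. u \<in> U \<Longrightarrow> \<rho> h1 *v u \<in> U" "\<And>u. u \<in> U \<Longrightarrow> \<rho> h2 *v u \<in> U"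
    and v: "v \<in> U" "v \<noteq> 0"
  shows "\<exists>\<mu>\<in>\<Lambda>. \<exists>w\<in>V \<mu> \<inter> U. w \<noteq> 0"
proof -
  obtain f where f: "v = (\<Sum>\<mu>\<in>\<Lambda>. f \<mu>)" "\<And>\<mu>. f \<mu> \<in> V \<mu>" using weight_sum by blast
  then obtain \<mu> where \<mu>: "\<mu> \<in> \<Lambda>" "f \<mu> \<noteq> 0" using v(2) by (metis sum.neutral)
  have "f \<mu> \<in> U"
    using weight_components_in_invariant_subspace[OF finite_weights U, of f \<mu>] f v(1) \<mu>(1) by simp
  then show ?thesis using f(2) \<mu> by blast
qed

lemma eigenvalues_h1: "eigenvalues (\<rho> h1) = fst ` \<Lambda>"
  and eigenvalues_h2: "eigenvalues (\<rho> h2) = snd ` \<Lambda>"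
proof -
  have comm: "\<rho> h1 *v (\<rho> h2 *v v) = \<rho> h2 *v (\<rho> h1 *v v)" for v
    by (simp add: rep_swap[of h1 h2] bb_generators bb_brackets rep_zero)
  have "l \<in> fst ` \<Lambda>" if l: "l \<in> eigenvalues (\<rho> h1)" for l
  proof -
    obtain v where v: "\<rho> h1 *v v = l *s v" "v \<noteq> 0" using l unfolding eigenvalues_def by blast
    have "\<exists>\<mu>\<in>\<Lambda>. \<exists>w\<in>V \<mu> \<inter> {v. \<rho> h1 *v v = l *s v}. w \<noteq> 0"
      by (rule weight_vector_in_invariant_subspace[OF subspace_eigenspace, of _ _ v])
        (simp_all add: v comm vector_scalar_commute)
    then obtain \<mu> w where w: "\<mu> \<in> \<Lambda>" "w \<in> V \<mu>" "\<rho> h1 *v w = l *s w" "w \<noteq> 0" by blast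
    then have "fst \<mu> *s w = l *s w" by (simp add: V_iff)
    then show ?thesis using w(1,4) by auto
  qed
  moreover have "l \<in> snd ` \<Lambda>" if l: "l \<in> eigenvalues (\<rho> h2)" for l
  proof -
    obtain v where v: "\<rho> h2 *v v = l *s v" "v \<noteq> 0" using l unfolding eigenvalues_def by blast
    have "\<exists>\<mu>\<in>\<Lambda>. \<exists>w\<in>V \<mu> \<inter> {v. \<rho> h2 *v v = l *s v}. w \<noteq> 0"
      by (rule weight_vector_in_invariant_subspace[OF subspace_eigenspace, of _ _ v])
        (simp_all add: v vector_scalar_commute flip: comm)
    then obtain \<mu> w where w: "\<mu> \<in> \<Lambda>" "w \<in> V \<mu>" "\<rho> h2 *v w = l *s w" "w \<noteq> 0" by blast
    then have "snd \<mu> *s w = l *s w" by (simp add: V_iff)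
    then show ?thesis using w(1,4) by auto
  qed
  moreover have "fst \<mu> \<in> eigenvalues (\<rho> h1) \<and> snd \<mu> \<in> eigenvalues (\<rho> h2)" if "\<mu> \<in> \<Lambda>" for \<mu>
  proof -
    obtain v where "v \<in> V \<mu>" "v \<noteq> 0" using \<open>\<mu> \<in> \<Lambda>\<close> by (rule weightE)
    then show ?thesis unfolding eigenvalues_def V_iff by blast
  qed
  ultimately show "eigenvalues (\<rho> h1) = fst ` \<Lambda>" "eigenvalues (\<rho> h2) = snd ` \<Lambda>"
    by blast+
qed

section \<open>Arrows between weights\<close>

lemma lowering_maps:
  assumes "(y, \<epsilon>) \<in> lowering" "v \<in> V \<mu>"
  shows "\<rho> y *v v \<in> V (\<mu> - \<epsilon>)"
proof -
  have "\<rho> (bb_scale (-1) y1) *v v = - (\<rho> y1 *v v)" "\<rho> (bb_scale (-1) y2) *v v = - (\<rho> y2 *v v)"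
    by (simp_all add: rep_scale bb_generators mat_scale_mult_vec)
  then show ?thesis
    using assms
    by (auto simp: lowering_def V_iff rep_swap[of h1 y1] rep_swap[of h2 y1] rep_swap[of h1 y2]
        rep_swap[of h2 y2] bb_generators bb_brackets rep_zero vector_scalar_commute
        vec.scale_left_diff_distrib)
qed

lemma lowering_commute: "\<rho> y1 *v (\<rho> y2 *v v) = \<rho> y2 *v (\<rho> y1 *v v)"
  by (simp add: rep_swap[of y1 y2] bb_generators bb_brackets rep_zero)

lemma arrow_nonzero:
  assumes "(\<mu>, \<nu>) \<in> arrows \<rho> y \<epsilon>" "v \<in> V \<mu>" "v \<noteq> 0"
  shows "\<rho> y *v v \<noteq> 0"
proof
  assume 0: "\<rho> y *v v = 0"
  obtain w where w: "w \<in> V \<mu>" "\<rho> y *v w \<noteq> 0" using assms(1) by (auto simp: arrows_def)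
  obtain c where "w = c *s v" using V_multiple[OF assms(2,3) w(1)] by blast
  then show False using w(2) 0 by (simp add: vector_scalar_commute)
qed

lemma arrow_weights:
  assumes "(y, \<epsilon>) \<in> lowering" "(\<mu>, \<nu>) \<in> arrows \<rho> y \<epsilon>"
  shows "\<mu> \<in> \<Lambda>" "\<nu> \<in> \<Lambda>" "\<nu> = \<mu> - \<epsilon>"
proof -
  from assms(2) obtain v where v: "v \<in> V \<mu>" "\<rho> y *v v \<noteq> 0" "\<nu> = \<mu> - \<epsilon>" by (auto simp: arrows_def)
  moreover from this have "v \<noteq> 0" by auto
  ultimately show "\<mu> \<in> \<Lambda>" "\<nu> \<in> \<Lambda>" "\<nu> = \<mu> - \<epsilon>"
    using lowering_maps[OF assms(1) v(1)] weightI[of v \<mu>] weightI[of "\<rho> y *v v" \<nu>] by auto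
qed

text \<open>
The vector \<open>\<rho> y' (\<rho> y v) = \<rho> y (\<rho> y' v)\<close> at the end of the two arrows is nonzero, so \<open>\<rho> y' v\<close> is nonzero
as well and gives the missing corner of the square.
\<close>
lemma arrows_commute_subset:
  assumes y: "(y, \<epsilon>) \<in> lowering" "(y', \<epsilon>') \<in> lowering"
    and comm: "\<And>v. \<rho> y *v (\<rho> y' *v v) = \<rho> y' *v (\<rho> y *v v)"
  shows "arrows \<rho> y \<epsilon> O arrows \<rho> y' \<epsilon>' \<subseteq> arrows \<rho> y' \<epsilon>' O arrows \<rho> y \<epsilon>"
proof clarify
  fix \<mu> \<nu> \<kappa> assume 1: "(\<mu>, \<nu>) \<in> arrows \<rho> y \<epsilon>" and 2: "(\<nu>, \<kappa>) \<in> arrows \<rho> y' \<epsilon>'"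
  from 1 obtain v where v: "v \<in> V \<mu>" "\<rho> y *v v \<noteq> 0" by (auto simp: arrows_def)
  have \<nu>: "\<nu> = \<mu> - \<epsilon>" and \<kappa>: "\<kappa> = \<mu> - \<epsilon>' - \<epsilon>"
    using arrow_weights(3)[OF y(1) 1] arrow_weights(3)[OF y(2) 2] by (simp_all add: algebra_simps)
  have "\<rho> y' *v (\<rho> y *v v) \<noteq> 0"
    using arrow_nonzero[OF 2] lowering_maps[OF y(1) v(1)] v(2) \<nu> by simp
  then have nz: "\<rho> y *v (\<rho> y' *v v) \<noteq> 0" by (simp add: comm)
  then have "\<rho> y' *v v \<noteq> 0" by auto
  then have "(\<mu>, \<mu> - \<epsilon>') \<in> arrows \<rho> y' \<epsilon>'" using v(1) unfolding arrows_def by blast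
  moreover have "(\<mu> - \<epsilon>', \<kappa>) \<in> arrows \<rho> y \<epsilon>"
    using nz lowering_maps[OF y(2) v(1)] \<kappa> unfolding arrows_def by blast
  ultimately show "(\<mu>, \<kappa>) \<in> arrows \<rho> y' \<epsilon>' O arrows \<rho> y \<epsilon>" by blast
qed

lemma arrows_commute:
  "arrows \<rho> y1 (1, 0) O arrows \<rho> y2 (0, 1) = arrows \<rho> y2 (0, 1) O arrows \<rho> y1 (1, 0)"
  by (intro equalityI arrows_commute_subset) (auto simp: lowering_def lowering_commute)

lemma link_weights:
  assumes "(\<mu>, \<nu>) \<in> weight_links \<rho>"
  shows "\<mu> \<in> \<Lambda>" "\<nu> \<in> \<Lambda>"
proof -
  have "(y1, (1, 0)) \<in> lowering" "(y2, (0, 1)) \<in> lowering" by (auto simp: lowering_def)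
  note w = arrow_weights(1,2)[OF this(1)] arrow_weights(1,2)[OF this(2)]
  show "\<mu> \<in> \<Lambda>" "\<nu> \<in> \<Lambda>"
    using assms unfolding weight_links_def by (blast intro: w)+
qed

lemma linked_sym: "(\<mu>, \<nu>) \<in> (weight_links \<rho>)\<^sup>* \<Longrightarrow> (\<nu>, \<mu>) \<in> (weight_links \<rho>)\<^sup>*"
proof -
  have "sym (weight_links \<rho>)" by (auto simp: weight_links_def sym_def)
  then show "(\<mu>, \<nu>) \<in> (weight_links \<rho>)\<^sup>* \<Longrightarrow> (\<nu>, \<mu>) \<in> (weight_links \<rho>)\<^sup>*"
    by (meson sym_rtrancl symD)
qed

abbreviation "linked \<mu> \<nu> \<equiv> (\<mu>, \<nu>) \<in> (weight_links \<rho>)\<^sup>*"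

lemma link_cases:
  assumes "(\<mu>, \<nu>) \<in> weight_links \<rho>"
  shows "\<nu> \<in> {\<mu> - (1, 0), \<mu> + (1, 0), \<mu> - (0, 1), \<mu> + (0, 1)}"
  using assms unfolding weight_links_def arrows_def by auto

section \<open>Indecomposability as connectedness of the weight graph\<close>

lemma V_subset_if_meets:
  assumes U: "vec.subspace U" and w: "w \<in> V \<mu>" "w \<in> U" "w \<noteq> 0"
  shows "V \<mu> \<subseteq> U"
proof
  fix z assume "z \<in> V \<mu>"
  then obtain c where "z = c *s w" using V_multiple[OF w(1,3)] by blast
  then show "z \<in> U" using vec.subspace_scale[OF U w(2)] by simp
qed

text \<open>
Each weight line lies in one of two complementary invariant subspaces, and an arrow forces its two
ends into the same one. If all weights are linked, the summand containing one weight line contains all of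
them, and nothing is left for the other summand.
\<close>
lemma linked_imp_indecomposable:
  assumes linked: "\<And>\<mu> \<nu>. \<mu> \<in> \<Lambda> \<Longrightarrow> \<nu> \<in> \<Lambda> \<Longrightarrow> linked \<mu> \<nu>"
  shows "indecomposable \<rho>"
  unfolding indecomposable_def
proof (intro notI, elim exE conjE)
  fix U W
  assume inv: "rep_invariant \<rho> U" "rep_invariant \<rho> W" and nz: "U \<noteq> {0}" "W \<noteq> {0}"
    and UW: "U \<inter> W = {0}" and sum: "{u + w | u w. u \<in> U \<and> w \<in> W} = UNIV"
  have U: "vec.subspace U" "\<And>X u. X \<in> bb_carrier \<Longrightarrow> u \<in> U \<Longrightarrow> \<rho> X *v u \<in> U"
    and W: "vec.subspace W" "\<And>X u. X \<in> bb_carrier \<Longrightarrow> u \<in> W \<Longrightarrow> \<rho> X *v u \<in> W"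
    using inv by (auto simp: rep_invariant_def)
  have split: "V \<mu> \<subseteq> U \<or> V \<mu> \<subseteq> W" if \<mu>: "\<mu> \<in> \<Lambda>" for \<mu>
  proof -
    obtain v where v: "v \<in> V \<mu>" "v \<noteq> 0" using \<mu> by (rule weightE)
    have "v \<in> {u + w | u w. u \<in> U \<and> w \<in> W}" by (simp add: sum)
    then obtain u w where uw: "v = u + w" "u \<in> U" "w \<in> W" by blast
    have same: "\<rho> X *v u = c *s u \<and> \<rho> X *v w = c *s w"
      if X: "X \<in> bb_carrier" and c: "\<rho> X *v v = c *s v" for X c
    proof -
      have eq: "\<rho> X *v u - c *s u = - (\<rho> X *v w - c *s w)"
        using c unfolding uw(1) matrix_vector_right_distrib vec.scale_right_distrib
        by (simp add: algebra_simps)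
      have "\<rho> X *v u - c *s u \<in> U"
        using uw(2) by (intro vec.subspace_diff vec.subspace_scale U X)
      moreover have "\<rho> X *v u - c *s u \<in> W"
        unfolding eq using uw(3)
        by (intro vec.subspace_neg vec.subspace_diff vec.subspace_scale W X)
      ultimately have "\<rho> X *v u - c *s u = 0" using UW by blast
      then show ?thesis using eq by simp
    qed
    have "u \<in> V \<mu>" "w \<in> V \<mu>"
      using same[OF bb_generators(1)] same[OF bb_generators(2)] v(1) by (simp_all add: V_iff)
    moreover have "u \<noteq> 0 \<or> w \<noteq> 0" using uw(1) v(2) by auto
    ultimately show ?thesis
      using V_subset_if_meets[OF U(1) _ uw(2)] V_subset_if_meets[OF W(1) _ uw(3)] by blast
  qed
  have disj: "v = 0" if "v \<in> U" "v \<in> W" for v using UW that by blast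
  \<comment> \<open>The image of a weight vector along an arrow is a witness in the target line for every invariant subspace that contains the source line.\<close>
  have arrow: "\<exists>z. z \<in> V \<nu> \<and> z \<noteq> 0 \<and> (\<forall>T. rep_invariant \<rho> T \<longrightarrow> V \<mu> \<subseteq> T \<longrightarrow> z \<in> T)"
    if a: "(\<mu>, \<nu>) \<in> arrows \<rho> y1 (1, 0) \<union> arrows \<rho> y2 (0, 1)" for \<mu> \<nu>
  proof -
    obtain y \<epsilon> where y: "(y, \<epsilon>) \<in> lowering" "(\<mu>, \<nu>) \<in> arrows \<rho> y \<epsilon>" "y \<in> bb_carrier"
      using a bb_generators unfolding lowering_def by blast
    obtain v where v: "v \<in> V \<mu>" "\<rho> y *v v \<noteq> 0" using y(2) unfolding arrows_def by blast
    have "\<rho> y *v v \<in> V \<nu>" using lowering_maps[OF y(1) v(1)] arrow_weights(3)[OF y(1,2)] by simp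
    then show ?thesis using v y(3) unfolding rep_invariant_def by blast
  qed
  have step: "V \<nu> \<subseteq> U" if link: "(\<mu>, \<nu>) \<in> weight_links \<rho>" and \<mu>: "V \<mu> \<subseteq> U" for \<mu> \<nu>
  proof -
    from link consider "(\<mu>, \<nu>) \<in> arrows \<rho> y1 (1, 0) \<union> arrows \<rho> y2 (0, 1)"
      | "(\<nu>, \<mu>) \<in> arrows \<rho> y1 (1, 0) \<union> arrows \<rho> y2 (0, 1)"
      unfolding weight_links_def by blast
    then show ?thesis
    proof cases
      case 1
      from arrow[OF this] obtain z where "z \<in> V \<nu>" "z \<noteq> 0" "z \<in> U" using inv(1) \<mu> by blast
      then show ?thesis using V_subset_if_meets[OF U(1)] by blast
    next
      case 2
      from arrow[OF this] obtain z where "z \<in> V \<mu>" "z \<noteq> 0" "V \<nu> \<subseteq> W \<Longrightarrow> z \<in> W"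
        using inv(2) by blast
      then have "\<not> V \<nu> \<subseteq> W" using \<mu> disj by blast
      then show ?thesis using split[OF link_weights(2)[OF link]] by blast
    qed
  qed
  obtain u where u: "u \<in> U" "u \<noteq> 0" using nz(1) vec.subspace_0[OF U(1)] by blast
  obtain w where w: "w \<in> W" "w \<noteq> 0" using nz(2) vec.subspace_0[OF W(1)] by blast
  obtain \<mu> u' where \<mu>: "\<mu> \<in> \<Lambda>" "u' \<in> V \<mu>" "u' \<in> U" "u' \<noteq> 0"
    using weight_vector_in_invariant_subspace[OF U(1) U(2)[OF bb_generators(1)] U(2)[OF bb_generators(2)] u]
    by blast
  obtain \<nu> w' where \<nu>: "\<nu> \<in> \<Lambda>" "w' \<in> V \<nu>" "w' \<in> W" "w' \<noteq> 0"
    using weight_vector_in_invariant_subspace[OF W(1) W(2)[OF bb_generators(1)] W(2)[OF bb_generators(2)] w]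
    by blast
  from linked[OF \<mu>(1) \<nu>(1)] have "V \<nu> \<subseteq> U"
  proof (induction rule: rtrancl_induct)
    case base
    show ?case using V_subset_if_meets[OF U(1) \<mu>(2,3,4)] .
  qed (rule step)
  then show False using disj \<nu> by blast
qed

definition weight_span :: "(complex \<times> complex) set \<Rightarrow> (complex^'n) set" where
  "weight_span C = {\<Sum>\<mu>\<in>C. f \<mu> | f. \<forall>\<mu>. f \<mu> \<in> V \<mu>}"

lemma subspace_weight_span: "vec.subspace (weight_span C)"
  unfolding vec.subspace_def
proof (intro conjI ballI allI)
  show "0 \<in> weight_span C"
    unfolding weight_span_def
    using vec.subspace_0[OF subspace_V] by (intro CollectI exI[of _ "\<lambda>_. 0"]) simp
next
  fix x y assume "x \<in> weight_span C" "y \<in> weight_span C"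
  then obtain f g where f: "x = sum f C" "\<forall>\<mu>. f \<mu> \<in> V \<mu>" and g: "y = sum g C" "\<forall>\<mu>. g \<mu> \<in> V \<mu>"
    unfolding weight_span_def by blast
  have "x + y = (\<Sum>\<mu>\<in>C. f \<mu> + g \<mu>)" by (simp add: f(1) g(1) sum.distrib)
  then show "x + y \<in> weight_span C"
    unfolding weight_span_def using f(2) g(2) vec.subspace_add[OF subspace_V] by blast
next
  fix c x assume "x \<in> weight_span C"
  then obtain f where f: "x = sum f C" "\<forall>\<mu>. f \<mu> \<in> V \<mu>" unfolding weight_span_def by blast
  have "c *s x = (\<Sum>\<mu>\<in>C. c *s f \<mu>)" unfolding f(1) by (rule vec.scale_sum_right)
  then show "c *s x \<in> weight_span C"
    unfolding weight_span_def using f(2) vec.subspace_scale[OF subspace_V] by blast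
qed

lemma V_subset_weight_span:
  assumes "finite C" "\<mu> \<in> C"
  shows "V \<mu> \<subseteq> weight_span C"
proof
  fix v assume v: "v \<in> V \<mu>"
  define f where "f \<nu> = (if \<nu> = \<mu> then v else 0)" for \<nu>
  have "sum f C = v" using assms by (simp add: f_def)
  moreover have "f \<nu> \<in> V \<nu>" for \<nu> using v vec.subspace_0[OF subspace_V] by (simp add: f_def)
  ultimately show "v \<in> weight_span C" unfolding weight_span_def by blast
qed

text \<open>
The elements of \<open>bb_carrier\<close> move vectors only along arrows, so a set of weights without arrows to the
remaining weights spans an invariant subspace.
\<close>
lemma weight_span_invariant:
  assumes C: "C \<subseteq> \<Lambda>" and closed: "\<And>\<mu> \<nu>. \<mu> \<in> C \<Longrightarrow> (\<mu>, \<nu>) \<in> weight_links \<rho> \<Longrightarrow> \<nu> \<in> C"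
  shows "rep_invariant \<rho> (weight_span C)"
proof (rule rep_invariantI[OF subspace_weight_span])
  have fin: "finite C" using C finite_weights by (rule finite_subset)
  fix X u assume X: "X \<in> {h1, h2, y1, y2}" and "u \<in> weight_span C"
  then obtain f where f: "u = sum f C" "\<And>\<mu>. f \<mu> \<in> V \<mu>" unfolding weight_span_def by blast
  have "\<rho> X *v f \<mu> \<in> weight_span C" if \<mu>: "\<mu> \<in> C" for \<mu>
  proof -
    from X consider "X \<in> {h1, h2}" | \<epsilon> where "(X, \<epsilon>) \<in> lowering"
      unfolding lowering_def by blast
    then show ?thesis
    proof cases
      case 1
      then obtain c where "\<rho> X *v f \<mu> = c *s f \<mu>" using f(2)[of \<mu>] by (auto simp: V_iff)
      then have "\<rho> X *v f \<mu> \<in> V \<mu>" using vec.subspace_scale[OF subspace_V f(2)] by simp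
      then show ?thesis using V_subset_weight_span[OF fin \<mu>] by blast
    next
      case (2 \<epsilon>)
      show ?thesis
      proof (cases "\<rho> X *v f \<mu> = 0")
        case True
        then show ?thesis using vec.subspace_0[OF subspace_weight_span] by simp
      next
        case False
        then have "(\<mu>, \<mu> - \<epsilon>) \<in> arrows \<rho> X \<epsilon>" using f(2) unfolding arrows_def by blast
        then have "(\<mu>, \<mu> - \<epsilon>) \<in> weight_links \<rho>"
          using 2 unfolding lowering_def weight_links_def by blast
        then have "\<mu> - \<epsilon> \<in> C" by (rule closed[OF \<mu>])
        then show ?thesis using V_subset_weight_span[OF fin] lowering_maps[OF 2 f(2)] by blast
      qed
    qed
  qed
  then show "\<rho> X *v u \<in> weight_span C"
    unfolding f(1) vec.linear_sum[OF matrix_vector_mul_linear_gen]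
    by (rule vec.subspace_sum[OF subspace_weight_span])
qed

text \<open>
If \<open>\<mu>\<close> and \<open>\<nu>\<close> are not linked, the weights linked to \<open>\<mu>\<close> and the remaining weights span two complementary
invariant subspaces, and neither is zero.
\<close>
lemma indecomposable_imp_linked:
  assumes indec: "indecomposable \<rho>" and \<mu>: "\<mu> \<in> \<Lambda>" and \<nu>: "\<nu> \<in> \<Lambda>"
  shows "linked \<mu> \<nu>"
proof (rule ccontr)
  assume not_linked: "\<not> linked \<mu> \<nu>"
  define C where "C = {\<kappa> \<in> \<Lambda>. linked \<mu> \<kappa>}"
  have C: "C \<subseteq> \<Lambda>" "\<mu> \<in> C" "\<nu> \<in> \<Lambda> - C" using \<mu> \<nu> not_linked by (auto simp: C_def)
  have fin: "finite C" "finite (\<Lambda> - C)" using finite_weights C(1) by (auto intro: finite_subset)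
  have "rep_invariant \<rho> (weight_span C)"
  proof (rule weight_span_invariant[OF C(1)])
    fix \<kappa> \<kappa>' assume \<kappa>: "\<kappa> \<in> C" and link: "(\<kappa>, \<kappa>') \<in> weight_links \<rho>"
    have "linked \<mu> \<kappa>" using \<kappa> by (simp add: C_def)
    from rtrancl_into_rtrancl[OF this link] have "linked \<mu> \<kappa>'" .
    then show "\<kappa>' \<in> C" using link_weights(2)[OF link] by (simp add: C_def)
  qed
  moreover have "rep_invariant \<rho> (weight_span (\<Lambda> - C))"
  proof (rule weight_span_invariant)
    fix \<kappa> \<kappa>' assume \<kappa>: "\<kappa> \<in> \<Lambda> - C" and link: "(\<kappa>, \<kappa>') \<in> weight_links \<rho>"
    have "linked \<kappa>' \<kappa>" using link linked_sym by blast
    then show "\<kappa>' \<in> \<Lambda> - C"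
      using \<kappa> link_weights(2)[OF link] rtrancl_trans[of \<mu> \<kappa>' _ \<kappa>] unfolding C_def by blast
  qed simp
  moreover have "weight_span C \<noteq> {0}" "weight_span (\<Lambda> - C) \<noteq> {0}"
  proof -
    obtain v w where "v \<in> V \<mu>" "v \<noteq> 0" "w \<in> V \<nu>" "w \<noteq> 0" using weightE[OF \<mu>] weightE[OF \<nu>] by metis
    then show "weight_span C \<noteq> {0}" "weight_span (\<Lambda> - C) \<noteq> {0}"
      using V_subset_weight_span[OF fin(1) C(2)] V_subset_weight_span[OF fin(2) C(3)] by blast+
  qed
  moreover have "weight_span C \<inter> weight_span (\<Lambda> - C) = {0}"
  proof -
    have "v = 0" if v: "v \<in> weight_span C" "v \<in> weight_span (\<Lambda> - C)" for v
    proof -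
      obtain f g where f: "v = sum f C" "\<And>\<kappa>. f \<kappa> \<in> V \<kappa>" and g: "v = sum g (\<Lambda> - C)" "\<And>\<kappa>. g \<kappa> \<in> V \<kappa>"
        using v unfolding weight_span_def by blast
      \<comment> \<open>Equating the two expansions of \<open>v\<close> gives a vanishing sum over all weights.\<close>
      define F where "F \<kappa> = (if \<kappa> \<in> C then f \<kappa> else - g \<kappa>)" for \<kappa>
      have "sum F \<Lambda> = sum F (\<Lambda> - C) + sum F C"
        by (rule sum.subset_diff[OF C(1) finite_weights])
      also have "sum F C = v" unfolding f(1) by (rule sum.cong) (auto simp: F_def)
      also have "sum F (\<Lambda> - C) = - v"
        unfolding g(1) sum_negf[symmetric] by (rule sum.cong) (auto simp: F_def)
      finally have "sum F \<Lambda> = 0" by simp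
      moreover have "F \<kappa> \<in> V \<kappa>" for \<kappa>
        using f(2) g(2) vec.subspace_neg[OF subspace_V] by (simp add: F_def)
      ultimately have "F \<kappa> \<in> {0}" if "\<kappa> \<in> \<Lambda>" for \<kappa>
        using weight_components_in_invariant_subspace[OF finite_weights vec.subspace_single_0 _ _ _ _ that, of F]
        by simp
      then have "F \<kappa> = 0" if "\<kappa> \<in> C" for \<kappa> using that C(1) by blast
      then have "f \<kappa> = 0" if "\<kappa> \<in> C" for \<kappa> using that by (simp add: F_def)
      then show "v = 0" using f(1) by simp
    qed
    then show ?thesis using vec.subspace_0[OF subspace_weight_span] by blast
  qed
  moreover have "{u + w | u w. u \<in> weight_span C \<and> w \<in> weight_span (\<Lambda> - C)} = UNIV"
  proof -
    have "\<exists>u w. v = u + w \<and> u \<in> weight_span C \<and> w \<in> weight_span (\<Lambda> - C)" for v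
    proof -
      obtain f where f: "v = sum f \<Lambda>" "\<forall>\<kappa>. f \<kappa> \<in> V \<kappa>" using weight_sum[of v] by blast
      have "v = sum f C + sum f (\<Lambda> - C)"
        unfolding f(1) sum.subset_diff[OF C(1) finite_weights] by (rule add.commute)
      then show ?thesis using f(2) unfolding weight_span_def by blast
    qed
    then show ?thesis by blast
  qed
  ultimately have "\<not> indecomposable \<rho>"
    unfolding indecomposable_def not_not
    by (intro exI[of _ "weight_span C"] exI[of _ "weight_span (\<Lambda> - C)"] conjI)
  then show False using indec by contradiction
qed

section \<open>Connected weight graphs\<close>

text \<open>
The combinatorial lemma \<open>walk_along_line\<close> applies in both directions: for \<open>y1\<close> the two coordinates
exchange their roles.
\<close>
lemma linked_in_line:
  assumes "(y, \<epsilon>) \<in> lowering" and link: "linked \<mu> (\<mu> - (of_nat m * fst \<epsilon>, of_nat m * snd \<epsilon>))"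
  shows "(\<mu>, \<mu> - (of_nat m * fst \<epsilon>, of_nat m * snd \<epsilon>)) \<in> arrows \<rho> y \<epsilon> ^^ m"
proof -
  let ?a = "arrows \<rho> y1 (1, 0)" and ?b = "arrows \<rho> y2 (0, 1)"
  have a: "fst \<nu> = fst \<mu> - 1 \<and> snd \<nu> = snd \<mu>" if "(\<mu>, \<nu>) \<in> ?a" for \<mu> \<nu>
    using that by (auto simp: arrows_def)
  have b: "fst \<nu> = fst \<mu> \<and> snd \<nu> = snd \<mu> - 1" if "(\<mu>, \<nu>) \<in> ?b" for \<mu> \<nu>
    using that by (auto simp: arrows_def)
  let ?\<nu> = "\<mu> - (of_nat m * fst \<epsilon>, of_nat m * snd \<epsilon>)"
  from assms(1) consider "y = y2" "\<epsilon> = (0, 1)" | "y = y1" "\<epsilon> = (1, 0)" unfolding lowering_def by blast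
  then show ?thesis
  proof cases
    case 1
    have "(\<mu>, ?\<nu>) \<in> ?b ^^ m"
    proof (rule walk_along_line[where f = fst and g = snd, OF prod_eqI a b arrows_commute])
      show "(\<mu>, ?\<nu>) \<in> (?a \<union> ?a\<inverse> \<union> ?b \<union> ?b\<inverse>)\<^sup>*"
        using link by (simp only: weight_links_def)
    qed (simp_all add: 1)
    then show ?thesis using 1 by simp
  next
    case 2
    have "(\<mu>, ?\<nu>) \<in> ?a ^^ m"
    proof (rule walk_along_line[where f = snd and g = fst, OF _ _ _ arrows_commute[symmetric]])
      show "(\<mu>, ?\<nu>) \<in> (?b \<union> ?b\<inverse> \<union> ?a \<union> ?a\<inverse>)\<^sup>*"
        using link by (simp only: weight_links_def Un_ac)
    qed (use a b in \<open>simp_all add: 2 prod_eqI\<close>)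
    then show ?thesis using 2 by simp
  qed
qed

lemma arrow_power_weight:
  assumes y: "(y, \<epsilon>) \<in> lowering" and \<mu>: "\<mu> \<in> \<Lambda>" and "(\<mu>, \<nu>) \<in> arrows \<rho> y \<epsilon> ^^ k"
  shows "\<nu> \<in> \<Lambda> \<and> \<nu> = \<mu> - (of_nat k * fst \<epsilon>, of_nat k * snd \<epsilon>)"
  using assms(3)
proof (induction k arbitrary: \<nu>)
  case 0
  then have "\<nu> = \<mu>" by simp
  show ?case unfolding \<open>\<nu> = \<mu>\<close> using \<mu> by (simp add: prod_eq_iff)
next
  case (Suc k)
  then obtain \<kappa> where "(\<mu>, \<kappa>) \<in> arrows \<rho> y \<epsilon> ^^ k" and \<nu>: "(\<kappa>, \<nu>) \<in> arrows \<rho> y \<epsilon>" by auto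
  then have "\<kappa> = \<mu> - (of_nat k * fst \<epsilon>, of_nat k * snd \<epsilon>)" using Suc.IH by blast
  then have "\<nu> = \<mu> - (of_nat (Suc k) * fst \<epsilon>, of_nat (Suc k) * snd \<epsilon>)"
    unfolding arrow_weights(3)[OF y \<nu>] by (simp add: prod_eq_iff algebra_simps)
  then show ?case using arrow_weights(2)[OF y \<nu>] by blast
qed

text \<open>
All the points passed by the straight walk are weights, since they carry the ends of arrows.
\<close>
lemma weights_convex_along_line:
  assumes y: "(y, \<epsilon>) \<in> lowering" and \<mu>: "\<mu> \<in> \<Lambda>"
    and link: "linked \<mu> (\<mu> - (of_nat m * fst \<epsilon>, of_nat m * snd \<epsilon>))" and k: "k \<le> m"
  shows "\<mu> - (of_nat k * fst \<epsilon>, of_nat k * snd \<epsilon>) \<in> \<Lambda>"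
proof -
  have "arrows \<rho> y \<epsilon> ^^ m = arrows \<rho> y \<epsilon> ^^ k O arrows \<rho> y \<epsilon> ^^ (m - k)"
    using k by (simp flip: relpow_add)
  then obtain \<nu> where "(\<mu>, \<nu>) \<in> arrows \<rho> y \<epsilon> ^^ k" using linked_in_line[OF y link] by blast
  then show ?thesis using arrow_power_weight[OF y \<mu>] by blast
qed

lemma arrow_image:
  assumes y: "(y, \<epsilon>) \<in> lowering" and arrow: "(\<mu>, \<nu>) \<in> arrows \<rho> y \<epsilon>"
  shows "(*v) (\<rho> y) ` V \<mu> = V \<nu>"
proof
  show "(*v) (\<rho> y) ` V \<mu> \<subseteq> V \<nu>"
    using lowering_maps[OF y] arrow_weights(3)[OF y arrow] by blast
  obtain v where v: "v \<in> V \<mu>" "\<rho> y *v v \<noteq> 0" using arrow unfolding arrows_def by blast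
  then have yv: "\<rho> y *v v \<in> V \<nu>" using lowering_maps[OF y] arrow_weights(3)[OF y arrow] by blast
  show "V \<nu> \<subseteq> (*v) (\<rho> y) ` V \<mu>"
  proof
    fix z assume "z \<in> V \<nu>"
    then obtain c where "z = c *s (\<rho> y *v v)" using V_multiple[OF yv v(2)] by blast
    then have "z = \<rho> y *v (c *s v)" by (simp only: vector_scalar_commute)
    then show "z \<in> (*v) (\<rho> y) ` V \<mu>" using vec.subspace_scale[OF subspace_V v(1)] by blast
  qed
qed

lemma weights_nonempty: "\<Lambda> \<noteq> {}"
proof -
  have "(1 :: complex^'n) \<noteq> 0" by simp
  then have "\<exists>\<mu>\<in>\<Lambda>. \<exists>w\<in>V \<mu> \<inter> UNIV. w \<noteq> 0"
    by (intro weight_vector_in_invariant_subspace[of UNIV 1]) (auto simp: vec.subspace_def)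
  then show ?thesis by blast
qed

text \<open>
A link changes each coordinate by \<open>-1\<close>, \<open>0\<close> or \<open>1\<close>, so linked weights project to a walk by such steps.
\<close>
lemma projected_weights_arithmetic:
  assumes linked: "\<And>\<mu> \<nu>. \<mu> \<in> \<Lambda> \<Longrightarrow> \<nu> \<in> \<Lambda> \<Longrightarrow> linked \<mu> \<nu>" and p: "p \<in> {fst, snd}"
  shows "\<exists>l. \<exists>s::nat. p ` \<Lambda> = {l - of_nat i | i. i \<le> s}"
proof -
  obtain \<mu> where \<mu>: "\<mu> \<in> \<Lambda>" using weights_nonempty by blast
  let ?R = "{(x, y). x \<in> p ` \<Lambda> \<and> y \<in> p ` \<Lambda> \<and> y \<in> {x - 1, x, x + 1}}"
  have "(p \<mu>, p \<nu>) \<in> ?R\<^sup>*" if "linked \<mu> \<nu>" for \<nu>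
    using that
  proof (induction rule: rtrancl_induct)
    case base
    show ?case by simp
  next
    case (step \<nu> \<kappa>)
    have "p \<kappa> \<in> {p \<nu> - 1, p \<nu>, p \<nu> + 1}" using link_cases[OF step.hyps(2)] p by auto
    then have "(p \<nu>, p \<kappa>) \<in> ?R" using link_weights[OF step.hyps(2)] by blast
    then show ?case using step.IH by (rule rtrancl_into_rtrancl[rotated])
  qed
  then have "(p \<mu>, x) \<in> ?R\<^sup>*" if "x \<in> p ` \<Lambda>" for x using that linked[OF \<mu>] by blast
  from finite_unit_step_connected_arithmetic[OF finite_imageI[OF finite_weights] imageI[OF \<mu>] this]
  show ?thesis .
qed

text \<open>
A walk from the column over \<open>l\<close> to the column over \<open>l - 1\<close> that never makes the step from one to the
other would remain in the columns \<open>l + k\<close> with a natural number \<open>k\<close>.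
\<close>
lemma linked_imp_P3:
  assumes linked: "\<And>\<mu> \<nu>. \<mu> \<in> \<Lambda> \<Longrightarrow> \<nu> \<in> \<Lambda> \<Longrightarrow> linked \<mu> \<nu>"
  shows "prop_P3 \<rho>"
  unfolding prop_P3_def eigenvalues_h1 eigenvalues_h2
proof (intro allI impI, elim conjE)
  fix l assume "l \<in> fst ` \<Lambda>" "l - 1 \<in> fst ` \<Lambda>"
  then obtain \<mu> \<nu> where \<mu>: "\<mu> \<in> \<Lambda>" "fst \<mu> = l" and \<nu>: "\<nu> \<in> \<Lambda>" "fst \<nu> = l - 1" by force
  have "\<exists>m. (l, m) \<in> \<Lambda> \<and> (l - 1, m) \<in> \<Lambda>"
  proof (rule ccontr)
    assume no_step: "\<not> ?thesis"
    have "\<exists>k::nat. fst \<kappa> = l + of_nat k" if "linked \<mu> \<kappa>" for \<kappa>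
      using that
    proof (induction rule: rtrancl_induct)
      case base
      show ?case using \<mu>(2) by (intro exI[of _ 0]) simp
    next
      case (step \<kappa> \<kappa>')
      then obtain k :: nat where k: "fst \<kappa> = l + of_nat k" by blast
      from link_cases[OF step.hyps(2)]
      consider "fst \<kappa>' = fst \<kappa>" | "fst \<kappa>' = fst \<kappa> + 1" | "\<kappa>' = (fst \<kappa> - 1, snd \<kappa>)"
        by (auto simp: prod_eq_iff)
      then show ?case
      proof cases
        case 1
        then show ?thesis using k by auto
      next
        case 2
        then show ?thesis using k by (intro exI[of _ "Suc k"]) simp
      next
        case 3
        have "k \<noteq> 0"
        proof
          assume "k = 0"
          then have "\<kappa> = (l, snd \<kappa>)" "\<kappa>' = (l - 1, snd \<kappa>)" using 3 k by (simp_all add: prod_eq_iff)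
          then show False using no_step link_weights[OF step.hyps(2)] by metis
        qed
        then show ?thesis using 3 k by (intro exI[of _ "k - 1"]) (simp add: of_nat_diff)
      qed
    qed
    from this[OF linked[OF \<mu>(1) \<nu>(1)]] obtain k :: nat where "l - 1 = l + of_nat k" using \<nu>(2) by auto
    then have "of_nat (Suc k) = (0 :: complex)" by (simp add: algebra_simps)
    then show False unfolding of_nat_eq_0_iff by simp
  qed
  then show "\<exists>m\<in>snd ` \<Lambda>. (l, m) \<in> \<Lambda> \<and> (l - 1, m) \<in> \<Lambda>" by force
qed

text \<open>
Neighbouring weights are joined by an arrow because of \<open>P4\<close>. By \<open>P1\<close> a column (a fixed first coordinate)
has no gaps, so all its weights are linked, and by \<open>P3\<close> each column is joined to the next one.
\<close>
lemma P1_P3_P4_imp_linked: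
  assumes eig1: "eigenvalues (\<rho> h1) = {l\<^sub>1 - of_nat i | i. i \<le> s}"
    and eig2: "eigenvalues (\<rho> h2) = {l\<^sub>2 - of_nat j | j. j \<le> t}"
    and P1: "prop_P1 \<rho> l\<^sub>1 l\<^sub>2 s t" and P3: "prop_P3 \<rho>" and P4: "prop_P4 \<rho> l\<^sub>1 l\<^sub>2"
    and \<mu>: "\<mu> \<in> \<Lambda>" and \<nu>: "\<nu> \<in> \<Lambda>"
  shows "linked \<mu> \<nu>"
proof -
  let ?w = "joint_wt l\<^sub>1 l\<^sub>2"
  have adjacent: "linked (?w \<theta>) (?w (\<theta> + \<delta>))"
    if y: "(y, \<delta>) \<in> {(y1, (1, 0)), (y2, (0, 1))}" and w: "?w \<theta> \<in> \<Lambda>" "?w (\<theta> + \<delta>) \<in> \<Lambda>" for y \<delta> \<theta>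
  proof -
    have img: "(*v) (\<rho> y) ` V (?w \<theta>) = V (?w (\<theta> + \<delta>))"
      using P4 y w unfolding prop_P4_def V_space_def by blast
    obtain z where "z \<in> V (?w (\<theta> + \<delta>))" "z \<noteq> 0" using w(2) by (rule weightE)
    then have nz: "\<exists>v\<in>V (?w \<theta>). \<rho> y *v v \<noteq> 0" unfolding img[symmetric] by blast
    have "?w (\<theta> + \<delta>) = ?w \<theta> - (of_nat (fst \<delta>), of_nat (snd \<delta>))"
      by (simp add: joint_wt_def)
    then have "(?w \<theta>, ?w (\<theta> + \<delta>)) \<in> arrows \<rho> y (of_nat (fst \<delta>), of_nat (snd \<delta>))"
      using nz unfolding arrows_def by blast
    then have "(?w \<theta>, ?w (\<theta> + \<delta>)) \<in> weight_links \<rho>"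
      using y unfolding weight_links_def by auto
    then show ?thesis by blast
  qed
  have upward: "linked (?w (i, j)) (?w (i, j + d))"
    if "i \<le> s" "j + d \<le> t" "?w (i, j) \<in> \<Lambda>" "?w (i, j + d) \<in> \<Lambda>" for i j d
    using that
  proof (induction d)
    case 0
    then show ?case by simp
  next
    case (Suc d)
    have mid: "?w (i, j + d) \<in> \<Lambda>"
    proof -
      have "j < j + Suc d" "j \<le> j + d" "j + d \<le> j + Suc d" by simp_all
      then show ?thesis using P1 Suc.prems unfolding prop_P1_def by blast
    qed
    have "linked (?w (i, j)) (?w (i, j + d))" using Suc mid by simp
    also have "linked (?w (i, j + d)) (?w (i, j + Suc d))"
      using adjacent[of y2 "(0, 1)" "(i, j + d)"] mid Suc.prems by simp
    finally show ?case .
  qed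
  have column: "linked (?w (i, j)) (?w (i, j'))"
    if "i \<le> s" "j \<le> t" "j' \<le> t" "?w (i, j) \<in> \<Lambda>" "?w (i, j') \<in> \<Lambda>" for i j j'
  proof (cases "j \<le> j'")
    case True
    then show ?thesis using upward[of i j "j' - j"] that by simp
  next
    case False
    then show ?thesis using upward[of i j' "j - j'"] that linked_sym by simp
  qed
  have coords: "\<exists>i j. \<kappa> = ?w (i, j) \<and> i \<le> s \<and> j \<le> t" if "\<kappa> \<in> \<Lambda>" for \<kappa>
  proof -
    have "fst \<kappa> \<in> {l\<^sub>1 - of_nat i | i. i \<le> s}" "snd \<kappa> \<in> {l\<^sub>2 - of_nat j | j. j \<le> t}"
      using that eig1 eig2 unfolding eigenvalues_h1 eigenvalues_h2 by blast+
    then show ?thesis by (auto simp: joint_wt_def prod_eq_iff)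
  qed
  have "l\<^sub>1 - of_nat 0 \<in> fst ` \<Lambda>" using eig1 unfolding eigenvalues_h1 by blast
  then obtain \<kappa> where "\<kappa> \<in> \<Lambda>" "fst \<kappa> = l\<^sub>1" by auto
  moreover from coords[OF \<open>\<kappa> \<in> \<Lambda>\<close>] obtain j0 where "j0 \<le> t" "snd \<kappa> = l\<^sub>2 - of_nat j0"
    by (auto simp: joint_wt_def)
  ultimately have "?w (0, j0) = \<kappa>" by (simp add: joint_wt_def prod_eq_iff)
  then have j0: "j0 \<le> t" "?w (0, j0) \<in> \<Lambda>" using \<open>j0 \<le> t\<close> \<open>\<kappa> \<in> \<Lambda>\<close> by simp_all
  have base: "linked (?w (0, j0)) (?w (i, j))" if "i \<le> s" "j \<le> t" "?w (i, j) \<in> \<Lambda>" for i j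
    using that
  proof (induction i arbitrary: j)
    case 0
    then show ?case using column j0 by blast
  next
    case (Suc i)
    have "l\<^sub>1 - of_nat i \<in> eigenvalues (\<rho> h1)" using eig1 Suc.prems(1) Suc_leD by blast
    moreover have "l\<^sub>1 - of_nat (Suc i) \<in> eigenvalues (\<rho> h1)" using eig1 Suc.prems(1) by blast
    then have "l\<^sub>1 - of_nat i - 1 \<in> eigenvalues (\<rho> h1)" by (simp add: algebra_simps)
    ultimately obtain m where m: "m \<in> eigenvalues (\<rho> h2)" "(l\<^sub>1 - of_nat i, m) \<in> \<Lambda>" "(l\<^sub>1 - of_nat i - 1, m) \<in> \<Lambda>"
      using P3 unfolding prop_P3_def by blast
    then obtain j' where j': "m = l\<^sub>2 - of_nat j'" "j' \<le> t" using eig2 by blast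
    have w: "?w (i, j') \<in> \<Lambda>" "?w (Suc i, j') \<in> \<Lambda>"
      using m(2,3) j'(1) by (simp_all add: joint_wt_def algebra_simps)
    have "linked (?w (0, j0)) (?w (i, j'))" using Suc.IH[OF _ j'(2) w(1)] Suc.prems(1) by simp
    also have "linked (?w (i, j')) (?w (Suc i, j'))"
      using adjacent[of y1 "(1, 0)" "(i, j')"] w by simp
    also have "linked (?w (Suc i, j')) (?w (Suc i, j))" using column w(2) j'(2) Suc.prems by blast
    finally show ?case .
  qed
  have "linked (?w (0, j0)) \<kappa>" if "\<kappa> \<in> \<Lambda>" for \<kappa>
    using base coords[OF that] that by blast
  from linked_sym[OF this[OF \<mu>]] this[OF \<nu>] show ?thesis by (rule rtrancl_trans)
qed

lemma linked_imp_P1: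
  assumes linked: "\<And>\<mu> \<nu>. \<mu> \<in> \<Lambda> \<Longrightarrow> \<nu> \<in> \<Lambda> \<Longrightarrow> linked \<mu> \<nu>"
  shows "prop_P1 \<rho> l\<^sub>1 l\<^sub>2 s t"
  unfolding prop_P1_def
proof (intro allI impI, elim conjE)
  fix i j\<^sub>1 j\<^sub>2 j :: nat
  assume w: "joint_wt l\<^sub>1 l\<^sub>2 (i, j\<^sub>1) \<in> \<Lambda>" "joint_wt l\<^sub>1 l\<^sub>2 (i, j\<^sub>2) \<in> \<Lambda>" and j: "j\<^sub>1 \<le> j" "j \<le> j\<^sub>2"
  have shift: "joint_wt l\<^sub>1 l\<^sub>2 (i, j\<^sub>1) - (of_nat k * fst (0, 1), of_nat k * snd (0, 1)) = joint_wt l\<^sub>1 l\<^sub>2 (i, j\<^sub>1 + k)" for k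
    by (simp add: joint_wt_def)
  have y: "(y2, (0, 1)) \<in> lowering" by (simp add: lowering_def)
  show "joint_wt l\<^sub>1 l\<^sub>2 (i, j) \<in> \<Lambda>"
    using weights_convex_along_line[OF y w(1), of "j\<^sub>2 - j\<^sub>1" "j - j\<^sub>1", unfolded shift] linked w j by simp
qed

lemma linked_imp_P2:
  assumes linked: "\<And>\<mu> \<nu>. \<mu> \<in> \<Lambda> \<Longrightarrow> \<nu> \<in> \<Lambda> \<Longrightarrow> linked \<mu> \<nu>"
  shows "prop_P2 \<rho> l\<^sub>1 l\<^sub>2 s t"
  unfolding prop_P2_def
proof (intro allI impI, elim conjE)
  fix j i\<^sub>1 i\<^sub>2 i :: nat
  assume w: "joint_wt l\<^sub>1 l\<^sub>2 (i\<^sub>1, j) \<in> \<Lambda>" "joint_wt l\<^sub>1 l\<^sub>2 (i\<^sub>2, j) \<in> \<Lambda>" and i: "i\<^sub>1 \<le> i" "i \<le> i\<^sub>2"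
  have shift: "joint_wt l\<^sub>1 l\<^sub>2 (i\<^sub>1, j) - (of_nat k * fst (1, 0), of_nat k * snd (1, 0)) = joint_wt l\<^sub>1 l\<^sub>2 (i\<^sub>1 + k, j)" for k
    by (simp add: joint_wt_def)
  have y: "(y1, (1, 0)) \<in> lowering" by (simp add: lowering_def)
  show "joint_wt l\<^sub>1 l\<^sub>2 (i, j) \<in> \<Lambda>"
    using weights_convex_along_line[OF y w(1), of "i\<^sub>2 - i\<^sub>1" "i - i\<^sub>1", unfolded shift] linked w i by simp
qed

lemma linked_imp_P4:
  assumes linked: "\<And>\<mu> \<nu>. \<mu> \<in> \<Lambda> \<Longrightarrow> \<nu> \<in> \<Lambda> \<Longrightarrow> linked \<mu> \<nu>"
  shows "prop_P4 \<rho> l\<^sub>1 l\<^sub>2"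
proof -
  let ?w = "joint_wt l\<^sub>1 l\<^sub>2"
  have "(*v) (\<rho> y) ` V (?w \<theta>) = V (?w (\<theta> + \<delta>))"
    if y: "(y, \<delta>) \<in> {(y1, (1, 0)), (y2, (0, 1))}" and w: "?w \<theta> \<in> \<Lambda>" "?w (\<theta> + \<delta>) \<in> \<Lambda>" for y \<delta> \<theta>
  proof -
    let ?\<epsilon> = "(of_nat (fst \<delta>), of_nat (snd \<delta>)) :: complex \<times> complex"
    have y: "(y, ?\<epsilon>) \<in> lowering" using y by (auto simp: lowering_def)
    have "?w (\<theta> + \<delta>) = ?w \<theta> - (of_nat 1 * fst ?\<epsilon>, of_nat 1 * snd ?\<epsilon>)" by (simp add: joint_wt_def)
    then have "(?w \<theta>, ?w (\<theta> + \<delta>)) \<in> arrows \<rho> y ?\<epsilon> ^^ 1"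
      using linked_in_line[OF y, of "?w \<theta>" 1] linked[OF w] by metis
    then show ?thesis using arrow_image[OF y] by simp
  qed
  then show ?thesis unfolding prop_P4_def V_space_def by blast
qed

end

theorem theorem5p3:
  fixes \<rho> :: "bb \<Rightarrow> complex^'n^'n"
  assumes "bb_rep \<rho>" and "multiplicity_free \<rho>"
  shows "indecomposable \<rho> \<longleftrightarrow>
    (\<exists>l\<^sub>1 l\<^sub>2 :: complex. \<exists>s t :: nat.
       eigenvalues (\<rho> h1) = {l\<^sub>1 - of_nat i | i. i \<le> s} \<and>
       eigenvalues (\<rho> h2) = {l\<^sub>2 - of_nat j | j. j \<le> t} \<and>
       prop_P1 \<rho> l\<^sub>1 l\<^sub>2 s t \<and>
       prop_P2 \<rho> l\<^sub>1 l\<^sub>2 s t \<and>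
       prop_P3 \<rho> \<and>
       prop_P4 \<rho> l\<^sub>1 l\<^sub>2)"
proof -
  interpret multiplicity_free_rep \<rho> using assms by unfold_locales
  show ?thesis
  proof
    assume indec: "indecomposable \<rho>"
    note linked = indecomposable_imp_linked[OF indec]
    obtain l\<^sub>1 l\<^sub>2 and s t :: nat where "fst ` \<Lambda> = {l\<^sub>1 - of_nat i | i. i \<le> s}" "snd ` \<Lambda> = {l\<^sub>2 - of_nat j | j. j \<le> t}"
      using projected_weights_arithmetic[OF linked, of fst] projected_weights_arithmetic[OF linked, of snd]
      by blast
    then show "\<exists>l\<^sub>1 l\<^sub>2. \<exists>s t. eigenvalues (\<rho> h1) = {l\<^sub>1 - of_nat i | i. i \<le> s} \<and>
       eigenvalues (\<rho> h2) = {l\<^sub>2 - of_nat j | j. j \<le> t} \<and> prop_P1 \<rho> l\<^sub>1 l\<^sub>2 s t \<and>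
       prop_P2 \<rho> l\<^sub>1 l\<^sub>2 s t \<and> prop_P3 \<rho> \<and> prop_P4 \<rho> l\<^sub>1 l\<^sub>2"
      unfolding eigenvalues_h1 eigenvalues_h2
      using linked_imp_P1[OF linked] linked_imp_P2[OF linked] linked_imp_P3[OF linked] linked_imp_P4[OF linked]
      by blast
  next
    assume "\<exists>l\<^sub>1 l\<^sub>2. \<exists>s t. eigenvalues (\<rho> h1) = {l\<^sub>1 - of_nat i | i. i \<le> s} \<and>
       eigenvalues (\<rho> h2) = {l\<^sub>2 - of_nat j | j. j \<le> t} \<and> prop_P1 \<rho> l\<^sub>1 l\<^sub>2 s t \<and>
       prop_P2 \<rho> l\<^sub>1 l\<^sub>2 s t \<and> prop_P3 \<rho> \<and> prop_P4 \<rho> l\<^sub>1 l\<^sub>2"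
    then show "indecomposable \<rho>"
      using P1_P3_P4_imp_linked by (intro linked_imp_indecomposable) blast
  qed
qed

end
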